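(* There is a constant $k_0>3$ such that for any integer $k\geq k_0$ and any real $r$ with $0<r\leq\frac1{25}\cdot 2^k/k$ the following holds. Let $m=\lceil rn\rceil$ and let $\Phi$ be a uniformly random $k$-CNF formula with $m$ clauses over the variables $x_1,\ldots,x_n$. Then $\texttt{Walksat}(\Phi,n)$ outputs a satisfying assignment of $\Phi$ with probability tending to $1$ as $n\to\infty$.
   Context: Random formula model: $V=\{x_1,\ldots,x_n\}$, literals $x_i,\bar x_i$. A $k$-CNF with $m$ clauses is an ordered $m$-tuple of clauses $\Phi=\Phi_1\wedge\cdots\wedge\Phi_m$, each clause an ordered $k$-tuple of literals $\Phi_i=\Phi_{i1}\vee\cdots\vee\Phi_{ik}$ (repetitions of literals within a clause and of clauses are allowed). The uniformly random formula $\Phi$ is drawn uniformly from all $(2n)^{km}$ such formulas (equivalently, the $km$ literals are independent and uniform over the $2n$ literals). For a literal $l$, $|l|$ is its underlying variable. The algorithm $\texttt{Walksat}(\Phi,T_{\max})$: start with the assignment $\sigma$ with $\sigma(x_i)=1$ for all $i$. Repeat the following $T_{\max}$ times, with independent random choices: if $\sigma$ satisfies $\Phi$, halt and output $\sigma$; otherwise choose an index $i$ such that $\Phi_i$ is unsatisfied under $\sigma$ uniformly at random among all such indices, choose $j\in\{1,\ldots,k\}$ uniformly at random, and flip the value $\sigma(|\Phi_{ij}|)$. If no satisfying assignment has been found after $T_{\max}$ iterations, return "failure". The probability is over both the random formula and the random choices of the algorithm. *)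

theory Defs
  imports "HOL-Probability.Probability_Mass_Function"
begin

datatype lit = Pos nat | Neg nat

primrec var_of :: "lit \<Rightarrow> nat" where
  "var_of (Pos i) = i"
| "var_of (Neg i) = i"

definition literals :: "nat \<Rightarrow> lit set" where
  "literals n = Pos ` {1..n} \<union> Neg ` {1..n}"

type_synonym clause = "lit list"
type_synonym cnf = "clause list"

text \<open>Only the values on \<open>{1..n}\<close> matter for a formula over \<open>n\<close> variables.\<close>

type_synonym assignment = "nat \<Rightarrow> bool"

primrec lit_true :: "assignment \<Rightarrow> lit \<Rightarrow> bool" where
  "lit_true \<sigma> (Pos i) \<longleftrightarrow> \<sigma> i"
| "lit_true \<sigma> (Neg i) \<longleftrightarrow> \<not> \<sigma> i"

definition sat_clause :: "assignment \<Rightarrow> clause \<Rightarrow> bool" where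
  "sat_clause \<sigma> C \<longleftrightarrow> (\<exists>l \<in> set C. lit_true \<sigma> l)"

definition sat_cnf :: "assignment \<Rightarrow> cnf \<Rightarrow> bool" where
  "sat_cnf \<sigma> \<Phi> \<longleftrightarrow> (\<forall>C \<in> set \<Phi>. sat_clause \<sigma> C)"

definition k_clauses :: "nat \<Rightarrow> nat \<Rightarrow> clause set" where
  "k_clauses k n = {C. set C \<subseteq> literals n \<and> length C = k}"

definition k_cnfs :: "nat \<Rightarrow> nat \<Rightarrow> nat \<Rightarrow> cnf set" where
  "k_cnfs k n m = {\<Phi>. set \<Phi> \<subseteq> k_clauses k n \<and> length \<Phi> = m}"

lemma finite_literals: "finite (literals n)"
  by (simp add: literals_def)

lemma card_literals: "card (literals n) = 2 * n"
proof -
  have "card (literals n) = card (Pos ` {1..n}) + card (Neg ` {1..n})"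
    unfolding literals_def by (rule card_Un_disjoint) auto
  also have "\<dots> = 2 * n"
    by (simp add: card_image inj_on_def)
  finally show ?thesis .
qed

lemma finite_k_clauses: "finite (k_clauses k n)"
  unfolding k_clauses_def by (rule finite_lists_length_eq[OF finite_literals])

lemma finite_k_cnfs: "finite (k_cnfs k n m)"
  unfolding k_cnfs_def by (rule finite_lists_length_eq[OF finite_k_clauses])

lemma card_k_cnfs: "card (k_cnfs k n m) = (2 * n) ^ (k * m)"
  unfolding k_cnfs_def card_lists_length_eq[OF finite_k_clauses]
  by (simp add: k_clauses_def card_lists_length_eq finite_literals card_literals power_mult)

definition random_k_cnf :: "nat \<Rightarrow> nat \<Rightarrow> nat \<Rightarrow> cnf pmf" where
  "random_k_cnf k n m = pmf_of_set (k_cnfs k n m)"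

definition unsat_indices :: "cnf \<Rightarrow> assignment \<Rightarrow> nat set" where
  "unsat_indices \<Phi> \<sigma> = {i. i < length \<Phi> \<and> \<not> sat_clause \<sigma> (\<Phi> ! i)}"

definition flip :: "assignment \<Rightarrow> nat \<Rightarrow> assignment" where
  "flip \<sigma> x = \<sigma>(x := \<not> \<sigma> x)"

text \<open>The natural number counts the remaining iterations; \<^term>\<open>None\<close> encodes failure.
  Satisfaction is tested only at the start of an iteration, so the assignment reached
  by the flip in the last iteration is not tested.\<close>

primrec walksat_from :: "cnf \<Rightarrow> nat \<Rightarrow> assignment \<Rightarrow> assignment option pmf" where
  "walksat_from \<Phi> 0 \<sigma> = return_pmf None"
| "walksat_from \<Phi> (Suc t) \<sigma> =
     (if sat_cnf \<sigma> \<Phi> then return_pmf (Some \<sigma>)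
      else do {
        i \<leftarrow> pmf_of_set (unsat_indices \<Phi> \<sigma>);
        j \<leftarrow> pmf_of_set {..<length (\<Phi> ! i)};
        walksat_from \<Phi> t (flip \<sigma> (var_of (\<Phi> ! i ! j)))
      })"

definition walksat :: "cnf \<Rightarrow> nat \<Rightarrow> assignment option pmf" where
  "walksat \<Phi> T = walksat_from \<Phi> T (\<lambda>_. True)"

text \<open>Joint law of the random formula and the output of the algorithm on it.\<close>

definition walksat_experiment ::
    "nat \<Rightarrow> nat \<Rightarrow> nat \<Rightarrow> nat \<Rightarrow> (cnf \<times> assignment option) pmf" where
  "walksat_experiment k n m T =
     do {
       \<Phi> \<leftarrow> random_k_cnf k n m;
       out \<leftarrow> walksat \<Phi> T;
       return_pmf (\<Phi>, out)
     }"

definition walksat_success :: "(cnf \<times> assignment option) set" where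
  "walksat_success = {(\<Phi>, out). \<exists>\<sigma>. out = Some \<sigma> \<and> sat_cnf \<sigma> \<Phi>}"

end

(* A selected clause is false under the current assignment, so each of its positive literals
   sits on a flipped variable; and a clause responsible for the last flip of a variable stays true
   from then on, so the flipped variables are those chosen in the last selections of the clauses. Hence a run that selects s = n div k distinct clauses exhibits s clauses whose
   positive literals all lie on s prescribed variables. A union bound over such configurations,
   in which the position choices of the algorithm enter with their probabilities, costs about
   2 e^2 / 25 < 1 per clause.

   So with high probability fewer than n / k distinct clauses are selected, and fewer than n / k
   variables flipped. For every set F of that size a typical formula has an assignment tau making
   all but k / 64 of the literals of every clause that lie on F true. A walk confined to F therefore
   drifts towards tau, and survives n steps with probability at most 8^|F| / 4^n, which beats the
   2^n choices of F. *)
theory Submission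
  imports Defs "HOL-Library.Sublist"
begin

subsection \<open>Traces of the walk\<close>

text \<open>The run depends on the formula, so conditioning on the run destroys the independence of
  the literals. Everything is therefore guessed in advance: the selected clauses and, for each, the
  position of its last choice. That position has k values, a factor k per clause that the union
  bound cannot afford. Early choices pay it back: a clause selected once has its only choice
  prescribed, at price 1/k, and in a clause selected more often the first two choices either
  coincide with each other or the last one, or land on further protected variables, a rare event
  when only s \<le> n/k variables are protected.

  The constant in the overview arises as follows. With s about n/k, choosing the clauses costs about
  e m/s = e 2^k/25 each, and a clause passes the test with probability about ((1 + 1/k)/2)^(k-1),
  roughly 2e/2^k.

  The set F of flipped variables also depends on the formula. A union over all F is affordable only
  for events of probability well below 2^-n. Clause sets of size proportional to n allow this;
  smaller ones need an event about the formula that does not mention F.\<close>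

lemma prob_bind_pmf:
  "measure_pmf.prob (bind_pmf M f) A = measure_pmf.expectation M (\<lambda>x. measure_pmf.prob (f x) A)"
proof -
  have "ennreal (measure_pmf.prob (bind_pmf M f) A)
      = (\<integral>\<^sup>+x. ennreal (measure_pmf.prob (f x) A) \<partial>measure_pmf M)"
    by (simp add: measure_pmf.emeasure_eq_measure[symmetric])
  also have "\<dots> = ennreal (measure_pmf.expectation M (\<lambda>x. measure_pmf.prob (f x) A))"
    by (rule nn_integral_eq_integral)
      (auto intro: measure_pmf.integrable_const_bound[where B = 1])
  finally show ?thesis
    by (simp add: integral_nonneg_AE)
qed

lemma prob_bind_pmf_of_set:
  assumes "finite S" "S \<noteq> {}"
  shows "measure_pmf.prob (bind_pmf (pmf_of_set S) f) A = (\<Sum>x\<in>S. measure_pmf.prob (f x) A) / card S"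
  by (simp add: prob_bind_pmf integral_pmf_of_set assms)

text \<open>A trace records the pairs (clause index, position) and stops once the formula is
  satisfied. Failure thus means full length \<open>t\<close>, including the case that the last flip
  reaches a satisfying assignment that is not tested any more.\<close>

primrec walk_trace :: "cnf \<Rightarrow> nat \<Rightarrow> assignment \<Rightarrow> (nat \<times> nat) list pmf" where
  "walk_trace \<Phi> 0 \<sigma> = return_pmf []"
| "walk_trace \<Phi> (Suc t) \<sigma> =
     (if sat_cnf \<sigma> \<Phi> then return_pmf []
      else do {
        i \<leftarrow> pmf_of_set (unsat_indices \<Phi> \<sigma>);
        j \<leftarrow> pmf_of_set {..<length (\<Phi> ! i)};
        map_pmf (Cons (i, j)) (walk_trace \<Phi> t (flip \<sigma> (var_of (\<Phi> ! i ! j))))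
      })"

lemma finite_unsat_indices [simp]: "finite (unsat_indices \<Phi> \<sigma>)"
  by (simp add: unsat_indices_def)

lemma unsat_indices_empty_iff [simp]: "unsat_indices \<Phi> \<sigma> = {} \<longleftrightarrow> sat_cnf \<sigma> \<Phi>"
  by (auto simp: unsat_indices_def sat_cnf_def all_set_conv_all_nth)

lemma prob_walksat_from_None:
  "measure_pmf.prob (walksat_from \<Phi> t \<sigma>) {None}
    = measure_pmf.prob (walk_trace \<Phi> t \<sigma>) {p. length p = t}"
proof (induction t arbitrary: \<sigma>)
  case 0
  then show ?case by simp
next
  case (Suc t)
  show ?case
    by (auto simp: prob_bind_pmf Suc.IH vimage_def)
qed

lemma walksat_from_sat:
  "Some \<tau> \<in> set_pmf (walksat_from \<Phi> t \<sigma>) \<Longrightarrow> sat_cnf \<tau> \<Phi>"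
  by (induction t arbitrary: \<sigma>) (auto split: if_splits)

text \<open>One-step induction rule for upper bounds. Averaging is done over the position only,
  while the bound is demanded for each unsatisfied clause separately; it then survives the average
  over the clauses.\<close>

lemma prob_walk_trace_Suc_le:
  fixes c :: real
  assumes len: "\<And>i. i < length \<Phi> \<Longrightarrow> length (\<Phi> ! i) = k" and "k > 0"
    and nil: "sat_cnf \<sigma> \<Phi> \<Longrightarrow> [] \<in> A \<Longrightarrow> 1 \<le> c"
    and c: "c \<ge> 0"
    and step: "\<And>i. i \<in> unsat_indices \<Phi> \<sigma> \<Longrightarrow>
      (\<Sum>j<k. measure_pmf.prob (walk_trace \<Phi> t (flip \<sigma> (var_of (\<Phi> ! i ! j)))) {p. (i, j) # p \<in> A})
        \<le> k * c"
  shows "measure_pmf.prob (walk_trace \<Phi> (Suc t) \<sigma>) A \<le> c"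
proof (cases "sat_cnf \<sigma> \<Phi>")
  case True
  then show ?thesis
    using nil c by (auto simp: indicator_def)
next
  case False
  let ?U = "unsat_indices \<Phi> \<sigma>"
  let ?g = "\<lambda>i j. measure_pmf.prob (walk_trace \<Phi> t (flip \<sigma> (var_of (\<Phi> ! i ! j)))) {p. (i, j) # p \<in> A}"
  have U: "?U \<noteq> {}" using False by simp
  have len': "length (\<Phi> ! i) = k" if "i \<in> ?U" for i
    using that len by (auto simp: unsat_indices_def)
  have ne: "{..<k} \<noteq> {}" using \<open>k > 0\<close> by auto
  have "measure_pmf.prob (walk_trace \<Phi> (Suc t) \<sigma>) A = (\<Sum>i\<in>?U. (\<Sum>j<k. ?g i j) / k) / card ?U"
    using False U ne by (simp add: prob_bind_pmf_of_set len' vimage_def cong: sum.cong)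
  also have "\<dots> \<le> (\<Sum>i\<in>?U. c) / card ?U"
    using step \<open>k > 0\<close>
    by (intro divide_right_mono sum_mono) (auto simp: field_simps)
  also have "\<dots> = c"
    using U by simp
  finally show ?thesis .
qed

section \<open>Replaying a trace on a fixed formula\<close>

primrec state_after :: "cnf \<Rightarrow> assignment \<Rightarrow> (nat \<times> nat) list \<Rightarrow> assignment" where
  "state_after \<Phi> \<sigma> [] = \<sigma>"
| "state_after \<Phi> \<sigma> (x # p) = state_after \<Phi> (flip \<sigma> (var_of (\<Phi> ! fst x ! snd x))) p"

text \<open>Captures the possible moves without asking that the trace run to the end, so that
  legality passes to prefixes. \<open>exists_witness\<close> truncates runs and relies on
  this.\<close>

primrec legal :: "cnf \<Rightarrow> assignment \<Rightarrow> (nat \<times> nat) list \<Rightarrow> bool" where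
  "legal \<Phi> \<sigma> [] \<longleftrightarrow> True"
| "legal \<Phi> \<sigma> (x # p) \<longleftrightarrow> fst x \<in> unsat_indices \<Phi> \<sigma> \<and> snd x < length (\<Phi> ! fst x) \<and>
     legal \<Phi> (flip \<sigma> (var_of (\<Phi> ! fst x ! snd x))) p"

lemma state_after_append: "state_after \<Phi> \<sigma> (p @ q) = state_after \<Phi> (state_after \<Phi> \<sigma> p) q"
  by (induction p arbitrary: \<sigma>) auto

lemma legal_append: "legal \<Phi> \<sigma> (p @ q) \<longleftrightarrow> legal \<Phi> \<sigma> p \<and> legal \<Phi> (state_after \<Phi> \<sigma> p) q"
  by (induction p arbitrary: \<sigma>) auto

lemma legal_walk_trace:
  assumes "\<And>i. i < length \<Phi> \<Longrightarrow> length (\<Phi> ! i) > 0"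
    and "p \<in> set_pmf (walk_trace \<Phi> t \<sigma>)"
  shows "legal \<Phi> \<sigma> p"
  using assms(2)
proof (induction t arbitrary: \<sigma> p)
  case 0
  then show ?case by simp
next
  case (Suc t)
  show ?case
  proof (cases "sat_cnf \<sigma> \<Phi>")
    case True
    then show ?thesis using Suc.prems by simp
  next
    case False
    have ne: "{..<length (\<Phi> ! i)} \<noteq> {}" if "i \<in> unsat_indices \<Phi> \<sigma>" for i
      using that assms(1)[of i] by (auto simp: unsat_indices_def)
    show ?thesis
      using Suc.prems Suc.IH False ne by (fastforce simp: set_pmf_of_set)
  qed
qed

definition touches :: "(nat \<times> nat) list \<Rightarrow> nat \<Rightarrow> nat list" where
  "touches p i = map snd (filter (\<lambda>x. fst x = i) p)"

definition touched :: "(nat \<times> nat) list \<Rightarrow> nat set" where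
  "touched p = fst ` set p"

definition flipped :: "cnf \<Rightarrow> (nat \<times> nat) list \<Rightarrow> nat set" where
  "flipped \<Phi> p = (\<lambda>x. var_of (\<Phi> ! fst x ! snd x)) ` set p"

lemma finite_touched [simp]: "finite (touched p)"
  by (simp add: touched_def)

lemma touches_eq_Nil_iff: "touches p i = [] \<longleftrightarrow> i \<notin> touched p"
  by (auto simp: touches_def touched_def filter_empty_conv)

lemma set_touches: "set (touches p i) = {j. (i, j) \<in> set p}"
  by (force simp: touches_def)

lemma legal_bounds:
  "legal \<Phi> \<sigma> p \<Longrightarrow> (i, j) \<in> set p \<Longrightarrow> i < length \<Phi> \<and> j < length (\<Phi> ! i)"
  by (induction p arbitrary: \<sigma>) (auto simp: unsat_indices_def)

text \<open>After the last flip of a variable, the clause that caused it contains a literal that stays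
  true, so that clause is never selected again.\<close>

lemma legal_invariant:
  assumes "legal \<Phi> (\<lambda>_. True) p"
  shows "(\<forall>x. \<not> state_after \<Phi> (\<lambda>_. True) p x \<longrightarrow> x \<in> flipped \<Phi> p) \<and>
    (\<forall>x\<in>flipped \<Phi> p. \<exists>i\<in>touched p. var_of (\<Phi> ! i ! last (touches p i)) = x \<and>
        lit_true (state_after \<Phi> (\<lambda>_. True) p) (\<Phi> ! i ! last (touches p i))) \<and>
    (\<forall>i\<in>touched p. \<forall>x. Pos x \<in> set (\<Phi> ! i) \<longrightarrow> x \<in> flipped \<Phi> p)"
  using assms
proof (induction p rule: rev_induct)
  case Nil
  then show ?case by (simp add: flipped_def touched_def)
next
  case (snoc a p)
  obtain i j where a: "a = (i, j)" by force
  define \<sigma> where "\<sigma> = state_after \<Phi> (\<lambda>_. True) p"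
  define l where "l = \<Phi> ! i ! j"
  define x where "x = var_of l"
  have legal: "legal \<Phi> (\<lambda>_. True) p" and i: "i \<in> unsat_indices \<Phi> \<sigma>" and j: "j < length (\<Phi> ! i)"
    using snoc.prems by (auto simp: legal_append a \<sigma>_def)
  have \<sigma>': "state_after \<Phi> (\<lambda>_. True) (p @ [a]) = flip \<sigma> x"
    by (simp add: state_after_append a \<sigma>_def l_def x_def)
  have F: "flipped \<Phi> (p @ [a]) = insert x (flipped \<Phi> p)"
    and S: "touched (p @ [a]) = insert i (touched p)"
    by (auto simp: flipped_def touched_def a l_def x_def)
  have unsat: "\<not> lit_true \<sigma> l'" if "l' \<in> set (\<Phi> ! i)" for l'
    using i that by (auto simp: unsat_indices_def sat_clause_def)
  note IH = snoc.IH[OF legal, folded \<sigma>_def]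
  have last_i: "last (touches (p @ [a]) i) = j"
    by (simp add: touches_def a)
  have last_o: "touches (p @ [a]) i' = touches p i'" if "i' \<noteq> i" for i'
    using that by (simp add: touches_def a)
  have l_flip: "lit_true (flip \<sigma> x) l"
    using unsat[of l] j by (cases l) (auto simp: flip_def x_def l_def)
  have o_flip: "lit_true (flip \<sigma> x) l' \<longleftrightarrow> lit_true \<sigma> l'" if "var_of l' \<noteq> x" for l'
    using that by (cases l') (auto simp: flip_def)
  have 1: "\<forall>y. \<not> flip \<sigma> x y \<longrightarrow> y \<in> insert x (flipped \<Phi> p)"
    using IH by (auto simp: flip_def)
  have 2: "\<exists>i'\<in>insert i (touched p). var_of (\<Phi> ! i' ! last (touches (p @ [a]) i')) = y \<and>
      lit_true (flip \<sigma> x) (\<Phi> ! i' ! last (touches (p @ [a]) i'))"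
    if y: "y \<in> insert x (flipped \<Phi> p)" for y
  proof (cases "y = x")
    case True
    then show ?thesis
      using l_flip by (auto simp: last_i l_def x_def)
  next
    case False
    then obtain i' where i': "i' \<in> touched p" "var_of (\<Phi> ! i' ! last (touches p i')) = y"
      "lit_true \<sigma> (\<Phi> ! i' ! last (touches p i'))"
      using IH y by auto
    have "last (touches p i') \<in> set (touches p i')"
      using i'(1) by (simp add: touches_eq_Nil_iff)
    then have "last (touches p i') < length (\<Phi> ! i')"
      using legal_bounds[OF legal] by (auto simp: set_touches)
    \<comment> \<open>At its selection clause \<open>i\<close> has only false literals, whereas
      \<open>i'\<close> holds a true one. The flip of \<open>x\<close> leaves that literal true,
      because its variable is \<open>y\<close>.\<close>
    then have "i' \<noteq> i"
      using unsat i'(3) by auto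
    then have "touches (p @ [a]) i' = touches p i'" by (rule last_o)
    then show ?thesis
      using i' False by (intro bexI[of _ i']) (simp_all add: o_flip)
  qed
  have 3: "\<forall>y. Pos y \<in> set (\<Phi> ! i) \<longrightarrow> y \<in> flipped \<Phi> p"
  proof (intro allI impI)
    fix y assume "Pos y \<in> set (\<Phi> ! i)"
    then have "\<not> \<sigma> y" using unsat by fastforce
    then show "y \<in> flipped \<Phi> p" using IH by blast
  qed
  have 4: "\<forall>i'\<in>insert i (touched p). \<forall>y. Pos y \<in> set (\<Phi> ! i') \<longrightarrow> y \<in> insert x (flipped \<Phi> p)"
    using 3 IH by blast
  show ?case
    unfolding \<sigma>' F S using 1 2 4 by blast
qed

lemma flipped_subset_last:
  assumes "legal \<Phi> (\<lambda>_. True) p"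
  shows "flipped \<Phi> p \<subseteq> (\<lambda>i. var_of (\<Phi> ! i ! last (touches p i))) ` touched p"
proof
  fix x assume "x \<in> flipped \<Phi> p"
  then obtain i where "i \<in> touched p" "var_of (\<Phi> ! i ! last (touches p i)) = x"
    using legal_invariant[OF assms] by blast
  then show "x \<in> (\<lambda>i. var_of (\<Phi> ! i ! last (touches p i))) ` touched p" by blast
qed

lemma card_flipped_le:
  assumes "legal \<Phi> (\<lambda>_. True) p"
  shows "card (flipped \<Phi> p) \<le> card (touched p)"
  by (rule surj_card_le[OF finite_touched flipped_subset_last[OF assms]])

text \<open>The positions chosen in successive selections of a clause are fresh uniform choices,
  independently of which clauses are selected.\<close>

lemma prob_touches_prefix_le:
  assumes len: "\<And>i. i < length \<Phi> \<Longrightarrow> length (\<Phi> ! i) = k" and "k > 0" and "finite S"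
  shows "measure_pmf.prob (walk_trace \<Phi> t \<sigma>) {p. \<forall>i\<in>S. prefix (g i) (touches p i)}
    \<le> (\<Prod>i\<in>S. (1 / k) ^ length (g i))"
proof (induction t arbitrary: \<sigma> g)
  case 0
  show ?case
  proof (cases "\<forall>i\<in>S. g i = []")
    case True
    then show ?thesis by simp
  next
    case False
    then have "[] \<notin> {p. \<forall>i\<in>S. prefix (g i) (touches p i)}" by (auto simp: touches_def)
    then have "measure_pmf.prob (walk_trace \<Phi> 0 \<sigma>) {p. \<forall>i\<in>S. prefix (g i) (touches p i)} = 0"
      by simp
    then show ?thesis by (simp add: prod_nonneg)
  qed
next
  case (Suc t)
  show ?case
  proof (rule prob_walk_trace_Suc_le[OF len \<open>k > 0\<close>])
    assume "[] \<in> {p. \<forall>i\<in>S. prefix (g i) (touches p i)}"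
    then show "1 \<le> (\<Prod>i\<in>S. (1 / real k) ^ length (g i))"
      by (simp add: touches_def)
  next
    show "0 \<le> (\<Prod>i\<in>S. (1 / real k) ^ length (g i))"
      by (intro prod_nonneg) auto
  next
    fix i assume i: "i \<in> unsat_indices \<Phi> \<sigma>"
    let ?tr = "\<lambda>j. walk_trace \<Phi> t (flip \<sigma> (var_of (\<Phi> ! i ! j)))"
    let ?E = "\<lambda>j. {p. (i, j) # p \<in> {p. \<forall>i\<in>S. prefix (g i) (touches p i)}}"
    let ?P = "\<lambda>g. \<Prod>i\<in>S. (1 / real k) ^ length (g i)"
    show "(\<Sum>j<k. measure_pmf.prob (?tr j) (?E j)) \<le> k * ?P g"
    \<comment> \<open>If clause \<open>i\<close> still has a prescribed position, exactly one of the
      \<open>k\<close> choices agrees with it, and what remains to be matched has a bound larger by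
      the factor \<open>k\<close>. Otherwise the move consumes nothing of the prescription.\<close>
    proof (cases "i \<in> S \<and> g i \<noteq> []")
      case False
      have "?E j = {p. \<forall>i\<in>S. prefix (g i) (touches p i)}" for j
      proof -
        have "prefix (g i') (touches ((i, j) # p) i') \<longleftrightarrow> prefix (g i') (touches p i')"
          if "i' \<in> S" for i' p
          using False that by (cases "i' = i") (auto simp: touches_def)
        then show ?thesis by auto
      qed
      then have "measure_pmf.prob (?tr j) (?E j) \<le> ?P g" for j
        using Suc.IH by simp
      then have "(\<Sum>j<k. measure_pmf.prob (?tr j) (?E j)) \<le> (\<Sum>j<k. ?P g)"
        by (intro sum_mono)
      then show ?thesis by simp
    next
      case True
      then obtain j0 r where g: "g i = j0 # r" by (cases "g i") auto
      define g' where "g' = g(i := r)"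
      have E1: "?E j = {}" if "j \<noteq> j0" for j
      proof -
        have "\<not> prefix (g i) (touches ((i, j) # p) i)" for p
          using that by (simp add: touches_def g)
        then show ?thesis using True by blast
      qed
      have E2: "?E j0 = {p. \<forall>i\<in>S. prefix (g' i) (touches p i)}"
      proof -
        have "prefix (g i') (touches ((i, j0) # p) i') \<longleftrightarrow> prefix (g' i') (touches p i')" for i' p
          by (cases "i' = i") (auto simp: touches_def g g'_def)
        then show ?thesis by simp
      qed
      have P: "?P g' = k * ?P g"
      proof -
        have split: "?P h = (1 / real k) ^ length (h i) * (\<Prod>i\<in>S - {i}. (1 / real k) ^ length (h i))" for h
          using True \<open>finite S\<close> by (subst prod.remove[of S i]) auto
        moreover have "(\<Prod>i\<in>S - {i}. (1 / real k) ^ length (g' i))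
            = (\<Prod>i\<in>S - {i}. (1 / real k) ^ length (g i))"
          by (rule prod.cong) (auto simp: g'_def)
        ultimately show ?thesis
          unfolding split[of g] split[of g'] using \<open>k > 0\<close> by (simp add: g'_def g)
      qed
      have "(\<Sum>j<k. measure_pmf.prob (?tr j) (?E j))
          \<le> (\<Sum>j<k. if j = j0 then ?P g' else 0)"
      proof (rule sum_mono)
        fix j
        show "measure_pmf.prob (?tr j) (?E j) \<le> (if j = j0 then ?P g' else 0)"
        proof (cases "j = j0")
          case True
          show ?thesis unfolding True E2 using Suc.IH[of _ g'] by simp
        next
          case False
          show ?thesis unfolding E1[OF False] using False by simp
        qed
      qed
      also have "\<dots> \<le> ?P g'"
        by (auto simp: sum.delta intro!: prod_nonneg)
      finally show ?thesis unfolding P .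
    qed
  qed auto
qed

text \<open>Each selection decreases the distance to \<open>\<tau>\<close> on \<open>F\<close> by one with probability at least
  \<open>63/64\<close>, so \<open>8\<close> to the power of the distance shrinks by the factor \<open>1/8 + 8/64 = 1/4\<close>
  in expectation.\<close>

lemma prob_confined_walk_le:
  assumes len: "\<And>i. i < length \<Phi> \<Longrightarrow> length (\<Phi> ! i) = k" and "k > 0" and "finite F"
    and \<tau>: "\<And>i. i < length \<Phi> \<Longrightarrow>
      64 * card {j. j < k \<and> var_of (\<Phi> ! i ! j) \<in> F \<and> \<not> lit_true \<tau> (\<Phi> ! i ! j)} \<le> k"
  shows "measure_pmf.prob (walk_trace \<Phi> t \<sigma>) {p. length p = t \<and> flipped \<Phi> p \<subseteq> F}
    \<le> 8 ^ card {x\<in>F. \<sigma> x \<noteq> \<tau> x} / 4 ^ t"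
proof (induction t arbitrary: \<sigma>)
  case 0
  have "measure_pmf.prob (walk_trace \<Phi> 0 \<sigma>) {p. length p = 0 \<and> flipped \<Phi> p \<subseteq> F} \<le> 1"
    by simp
  also have "1 \<le> (8::real) ^ card {x\<in>F. \<sigma> x \<noteq> \<tau> x}"
    by (rule one_le_power) simp
  finally show ?case by simp
next
  case (Suc t)
  let ?D = "\<lambda>\<sigma>. {x\<in>F. \<sigma> x \<noteq> \<tau> x}"
  define c where "c = (8::real) ^ card (?D \<sigma>) / 4 ^ t"
  have "c \<ge> 0" by (simp add: c_def)
  have "measure_pmf.prob (walk_trace \<Phi> (Suc t) \<sigma>) {p. length p = Suc t \<and> flipped \<Phi> p \<subseteq> F} \<le> c / 4"
  proof (rule prob_walk_trace_Suc_le[OF len \<open>k > 0\<close>])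
    fix i assume i: "i \<in> unsat_indices \<Phi> \<sigma>"
    then have iL: "i < length \<Phi>" by (simp add: unsat_indices_def)
    define B where "B = {j. j < k \<and> var_of (\<Phi> ! i ! j) \<in> F \<and> \<not> lit_true \<tau> (\<Phi> ! i ! j)}"
    let ?P = "\<lambda>j. measure_pmf.prob (walk_trace \<Phi> t (flip \<sigma> (var_of (\<Phi> ! i ! j))))
      {p. (i, j) # p \<in> {p. length p = Suc t \<and> flipped \<Phi> p \<subseteq> F}}"
    have P: "?P j \<le> c / 8 + (if j \<in> B then 8 * c else 0)" if j: "j < k" for j
    proof (cases "var_of (\<Phi> ! i ! j) \<in> F")
      case False
      then have empty: "{p. (i, j) # p \<in> {p. length p = Suc t \<and> flipped \<Phi> p \<subseteq> F}} = {}"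
        by (auto simp: flipped_def)
      show ?thesis using \<open>c \<ge> 0\<close> unfolding empty by simp
    next
      case True
      define l where "l = \<Phi> ! i ! j"
      define \<sigma>' where "\<sigma>' = flip \<sigma> (var_of l)"
      have unsat: "\<not> lit_true \<sigma> l"
        using i j len[OF iL] by (auto simp: unsat_indices_def sat_clause_def l_def)
      have "{p. (i, j) # p \<in> {p. length p = Suc t \<and> flipped \<Phi> p \<subseteq> F}}
          = {p. length p = t \<and> flipped \<Phi> p \<subseteq> F}"
        using True by (auto simp: flipped_def)
      then have le: "?P j \<le> 8 ^ card (?D \<sigma>') / 4 ^ t"
        using Suc.IH by (simp add: \<sigma>'_def l_def)
      show ?thesis
      proof (cases "j \<in> B")
        \<comment> \<open>The literal is false under \<open>\<sigma>\<close> and true under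
          \<open>\<tau>\<close>, so its variable is a disagreement inside \<open>F\<close>, and the
          flip removes it.\<close>
        case False
        then have "lit_true \<tau> l" using True j by (simp add: B_def l_def)
        then have "?D \<sigma> = insert (var_of l) (?D \<sigma>')" "var_of l \<notin> ?D \<sigma>'"
          using True unsat by (cases l; auto simp: \<sigma>'_def flip_def l_def)+
        then have "card (?D \<sigma>) = Suc (card (?D \<sigma>'))"
          using \<open>finite F\<close> by simp
        then have eq: "8 ^ card (?D \<sigma>') / 4 ^ t = c / 8" by (simp add: c_def)
        show ?thesis using le[unfolded eq] False by (simp only: if_False add_0_right)
      next
        case True
        have "?D \<sigma>' \<subseteq> insert (var_of l) (?D \<sigma>)"
          by (auto simp: \<sigma>'_def flip_def)
        then have "card (?D \<sigma>') \<le> card (insert (var_of l) (?D \<sigma>))"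
          using \<open>finite F\<close> by (intro card_mono) auto
        also have "\<dots> \<le> Suc (card (?D \<sigma>))"
          by (rule card_insert_le_m1) auto
        finally have "(8::real) ^ card (?D \<sigma>') \<le> 8 ^ Suc (card (?D \<sigma>))"
          by (intro power_increasing) auto
        then have "8 ^ card (?D \<sigma>') / 4 ^ t \<le> 8 * c"
          by (simp add: c_def divide_right_mono)
        then have "?P j \<le> 8 * c" by (rule order_trans[OF le])
        then show ?thesis using True \<open>c \<ge> 0\<close> by (simp only: if_True)
      qed
    qed
    have "(\<Sum>j<k. ?P j) \<le> (\<Sum>j<k. c / 8 + (if j \<in> B then 8 * c else 0))"
      by (intro sum_mono P) simp
    also have "\<dots> = k * (c / 8) + card B * (8 * c)"
    proof -
      have B: "{..<k} \<inter> B = B" by (auto simp: B_def)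
      have "(\<Sum>j<k. if j \<in> B then 8 * c else 0) = (\<Sum>j\<in>B. 8 * c)"
        using sum.inter_restrict[of "{..<k}" "\<lambda>_. 8 * c" B] unfolding B by simp
      then show ?thesis by (simp only: sum.distrib sum_constant card_lessThan)
    qed
    also have "\<dots> \<le> k * (c / 8) + (k / 64) * (8 * c)"
      using \<tau>[OF iL] \<open>c \<ge> 0\<close> by (intro add_left_mono mult_right_mono) (auto simp: B_def)
    also have "\<dots> = k * (c / 4)" by simp
    finally show "(\<Sum>j<k. ?P j) \<le> k * (c / 4)" .
  qed (use \<open>c \<ge> 0\<close> in auto)
  then show ?case by (simp add: c_def)
qed

subsection \<open>Orienting the flipped variables\<close>

lemma prob_UN_le:
  fixes c :: real
  assumes "finite I" "\<And>i. i \<in> I \<Longrightarrow> measure_pmf.prob M (A i) \<le> c"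
  shows "measure_pmf.prob M (\<Union>i\<in>I. A i) \<le> card I * c"
proof -
  have "measure_pmf.prob M (\<Union>i\<in>I. A i) \<le> (\<Sum>i\<in>I. measure_pmf.prob M (A i))"
    by (rule measure_UNION_le) (use assms in auto)
  also have "\<dots> \<le> (\<Sum>i\<in>I. c)"
    by (rule sum_mono) (use assms in auto)
  finally show ?thesis by simp
qed

section \<open>Counting formulas with constrained literals\<close>

abbreviation lit_at :: "cnf \<Rightarrow> nat \<times> nat \<Rightarrow> lit" where
  "lit_at \<Phi> x \<equiv> \<Phi> ! fst x ! snd x"

lemma lit_at_in_literals:
  assumes "\<Phi> \<in> k_cnfs k n m" "x \<in> {..<m} \<times> {..<k}"
  shows "lit_at \<Phi> x \<in> literals n"
proof -
  have "fst x < length \<Phi>" using assms by (auto simp: k_cnfs_def)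
  then have "\<Phi> ! fst x \<in> k_clauses k n"
    using assms(1) nth_mem by (auto simp: k_cnfs_def)
  moreover have "snd x < k" using assms(2) by auto
  ultimately show ?thesis
    using nth_mem by (auto simp: k_clauses_def)
qed

lemma k_cnfs_eqI:
  assumes "\<Phi> \<in> k_cnfs k n m" "\<Psi> \<in> k_cnfs k n m"
    and "\<And>x. x \<in> {..<m} \<times> {..<k} \<Longrightarrow> lit_at \<Phi> x = lit_at \<Psi> x"
  shows "\<Phi> = \<Psi>"
proof (rule nth_equalityI)
  show "length \<Phi> = length \<Psi>" using assms(1,2) by (simp add: k_cnfs_def)
next
  fix i assume i: "i < length \<Phi>"
  then have im: "i < m" "\<Phi> ! i \<in> k_clauses k n" "\<Psi> ! i \<in> k_clauses k n"
    using assms(1,2) by (auto simp: k_cnfs_def subset_iff)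
  show "\<Phi> ! i = \<Psi> ! i"
  proof (rule nth_equalityI)
    show "length (\<Phi> ! i) = length (\<Psi> ! i)" using im by (simp add: k_clauses_def)
    fix j assume "j < length (\<Phi> ! i)"
    then have "j < k" using im by (simp add: k_clauses_def)
    then show "\<Phi> ! i ! j = \<Psi> ! i ! j" using assms(3)[of "(i, j)"] im by simp
  qed
qed

lemma k_cnfs_nonempty:
  assumes "n > 0"
  shows "k_cnfs k n m \<noteq> {}"
proof -
  have "card (k_cnfs k n m) > 0" using assms by (simp add: card_k_cnfs)
  then show ?thesis by auto
qed

text \<open>Expose the literals at the positions in \<open>K\<close>. The others stay independent
  and uniform, so each hits its target set with probability at most \<open>c x\<close>, although the
  targets may depend on the exposed literals. Conditioning is avoided by counting: a formula is
  determined by its restrictions to \<open>K\<close> and to the remaining positions.\<close>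

lemma prob_random_k_cnf_le:
  fixes c :: "nat \<times> nat \<Rightarrow> real"
  assumes "n > 0" and K: "K \<subseteq> {..<m} \<times> {..<k}"
    and c: "\<And>x \<psi>. x \<in> {..<m} \<times> {..<k} - K \<Longrightarrow> card (A x \<psi> \<inter> literals n) \<le> c x * (2 * n)"
  shows "measure_pmf.prob (random_k_cnf k n m)
      {\<Phi>. \<forall>x\<in>{..<m} \<times> {..<k} - K. lit_at \<Phi> x \<in> A x (restrict (lit_at \<Phi>) K)}
    \<le> (\<Prod>x\<in>{..<m} \<times> {..<k} - K. c x)"
proof -
  define I where "I = {..<m} \<times> {..<k}"
  define L where "L = literals n"
  define E where "E = {\<Phi>. \<forall>x\<in>I - K. lit_at \<Phi> x \<in> A x (restrict (lit_at \<Phi>) K)}"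
  define W where "W = (SIGMA \<psi>:K \<rightarrow>\<^sub>E L. (\<Pi>\<^sub>E x\<in>I - K. A x \<psi> \<inter> L))"
  have fin: "finite I" "finite K" "finite L"
    using K finite_subset by (auto simp: I_def L_def finite_literals)
  have KI: "K \<subseteq> I" using K by (simp add: I_def)
  have finPiE: "finite (K \<rightarrow>\<^sub>E L)" "finite (\<Pi>\<^sub>E x\<in>I - K. A x \<psi> \<inter> L)" for \<psi>
    using fin by (auto intro!: finite_PiE)
  have finW: "finite W"
    unfolding W_def using finPiE by (intro finite_SigmaI) auto
  let ?h = "\<lambda>\<Phi>. (restrict (lit_at \<Phi>) K, restrict (lit_at \<Phi>) (I - K))"
  have "inj_on ?h (k_cnfs k n m \<inter> E)"
  proof (rule inj_onI)
    fix \<Phi> \<Psi> assume \<Phi>\<Psi>: "\<Phi> \<in> k_cnfs k n m \<inter> E" "\<Psi> \<in> k_cnfs k n m \<inter> E" and eq: "?h \<Phi> = ?h \<Psi>"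
    show "\<Phi> = \<Psi>"
    proof (rule k_cnfs_eqI[of _ k n m])
      fix x assume "x \<in> {..<m} \<times> {..<k}"
      then have "x \<in> K \<or> x \<in> I - K" by (auto simp: I_def)
      then show "lit_at \<Phi> x = lit_at \<Psi> x"
        using eq by (auto dest!: fun_cong[where x = x])
    qed (use \<Phi>\<Psi> in auto)
  qed
  moreover have "?h ` (k_cnfs k n m \<inter> E) \<subseteq> W"
  proof
    fix w assume "w \<in> ?h ` (k_cnfs k n m \<inter> E)"
    then obtain \<Phi> where \<Phi>: "\<Phi> \<in> k_cnfs k n m" "\<Phi> \<in> E" and w: "w = ?h \<Phi>" by blast
    have L: "lit_at \<Phi> x \<in> L" if "x \<in> I" for x
      using lit_at_in_literals[OF \<Phi>(1)] that by (simp add: I_def L_def)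
    have "restrict (lit_at \<Phi>) K \<in> K \<rightarrow>\<^sub>E L"
      using L KI by (intro restrict_PiE_iff[THEN iffD2]) blast
    moreover have "restrict (lit_at \<Phi>) (I - K) \<in> (\<Pi>\<^sub>E x\<in>I - K. A x (restrict (lit_at \<Phi>) K) \<inter> L)"
      using L \<Phi>(2) unfolding E_def by (intro restrict_PiE_iff[THEN iffD2]) blast
    ultimately show "w \<in> W" unfolding W_def w by blast
  qed
  ultimately have "card (k_cnfs k n m \<inter> E) \<le> card W"
    using finW by (rule card_inj_on_le)
  also have "card W = (\<Sum>\<psi>\<in>K \<rightarrow>\<^sub>E L. \<Prod>x\<in>I - K. card (A x \<psi> \<inter> L))"
    unfolding W_def using finPiE fin by (simp add: card_SigmaI card_PiE)
  finally have "real (card (k_cnfs k n m \<inter> E)) \<le> real (\<Sum>\<psi>\<in>K \<rightarrow>\<^sub>E L. \<Prod>x\<in>I - K. card (A x \<psi> \<inter> L))"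
    by (rule of_nat_mono)
  also have "\<dots> = (\<Sum>\<psi>\<in>K \<rightarrow>\<^sub>E L. \<Prod>x\<in>I - K. real (card (A x \<psi> \<inter> L)))"
    by (simp only: of_nat_sum of_nat_prod)
  also have "\<dots> \<le> (\<Sum>\<psi>\<in>K \<rightarrow>\<^sub>E L. \<Prod>x\<in>I - K. c x * (2 * n))"
    using c[folded I_def L_def] by (intro sum_mono prod_mono conjI) auto
  also have "\<dots> = (2 * n) ^ card K * ((\<Prod>x\<in>I - K. c x) * (2 * n) ^ card (I - K))"
    using fin by (simp add: card_PiE prod.distrib L_def card_literals)
  also have "\<dots> = (2 * n) ^ card I * (\<Prod>x\<in>I - K. c x)"
  proof -
    have "card I = card K + card (I - K)"
      using fin KI by (simp add: card_Diff_subset card_mono)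
    then show ?thesis by (simp add: power_add)
  qed
  also have "card I = k * m" by (simp add: I_def)
  finally have "real (card (k_cnfs k n m \<inter> E)) \<le> (2 * n) ^ (k * m) * (\<Prod>x\<in>I - K. c x)" .
  then have "measure_pmf.prob (random_k_cnf k n m) E \<le> (\<Prod>x\<in>I - K. c x)"
    using \<open>n > 0\<close> unfolding random_k_cnf_def
    by (subst measure_pmf_of_set)
      (auto simp: finite_k_cnfs k_cnfs_nonempty card_k_cnfs field_simps)
  then show ?thesis by (simp add: E_def I_def)
qed

lemma card_literals_over_le:
  assumes "finite V"
  shows "card ({l. var_of l \<in> V} \<inter> literals n) \<le> 2 * card V"
proof -
  have "{l. var_of l \<in> V} \<inter> literals n \<subseteq> Pos ` V \<union> Neg ` V"
    by (auto simp: literals_def)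
  then have "card ({l. var_of l \<in> V} \<inter> literals n) \<le> card (Pos ` V \<union> Neg ` V)"
    using assms by (intro card_mono) auto
  also have "\<dots> \<le> card (Pos ` V) + card (Neg ` V)"
    by (rule card_Un_le)
  also have "\<dots> \<le> card V + card V"
    using assms by (intro add_mono card_image_le)
  finally show ?thesis by simp
qed

text \<open>Here everything outside \<open>Q\<close> is exposed. A constant \<open>V\<close> gives
  confinement to a fixed variable set; a \<open>V\<close> read off the exposed literals gives
  repetitions within the formula.\<close>

lemma prob_vars_confined_le:
  assumes "n > 0" and Q: "Q \<subseteq> {..<m} \<times> {..<k}"
    and V: "\<And>\<psi>. finite (V \<psi>) \<and> card (V \<psi>) \<le> v"
  shows "measure_pmf.prob (random_k_cnf k n m)
      {\<Phi>. \<forall>x\<in>Q. var_of (lit_at \<Phi> x) \<in> V (restrict (lit_at \<Phi>) ({..<m} \<times> {..<k} - Q))}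
    \<le> (v / n) ^ card Q"
proof -
  let ?I = "{..<m} \<times> {..<k}"
  have Q': "?I - (?I - Q) = Q" using Q by auto
  have "real (card ({l. var_of l \<in> V \<psi>} \<inter> literals n)) \<le> (v / n) * (2 * n)" for \<psi>
  proof -
    have "card ({l. var_of l \<in> V \<psi>} \<inter> literals n) \<le> 2 * v"
      using card_literals_over_le[of "V \<psi>" n] V[of \<psi>] by linarith
    then have "real (card ({l. var_of l \<in> V \<psi>} \<inter> literals n)) \<le> real (2 * v)"
      by (rule of_nat_mono)
    then show ?thesis using \<open>n > 0\<close> by simp
  qed
  then show ?thesis
    using prob_random_k_cnf_le[of n "?I - Q" m k "\<lambda>_ \<psi>. {l. var_of l \<in> V \<psi>}" "\<lambda>_. v / n"] \<open>n > 0\<close>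
    unfolding Q' by simp
qed

section \<open>Existence of an orientation in formulas without exceptional clause sets\<close>

lemma half_repeats:
  assumes "finite X" and rep: "\<And>x. x \<in> X \<Longrightarrow> \<exists>y\<in>X. y \<noteq> x \<and> f y = f x"
  shows "\<exists>Q\<subseteq>X. card X \<le> 2 * card Q \<and> f ` Q \<subseteq> f ` (X - Q)"
proof (intro exI conjI)
  \<comment> \<open>One representative of each fibre of \<open>f\<close> is kept out of
    \<open>Q\<close>. Every fibre has at least two elements, so the representatives are at most half
    of \<open>X\<close>.\<close>
  let ?R = "inv_into X f ` f ` X"
  have RX: "?R \<subseteq> X" by (auto intro: inv_into_into)
  have fR: "f ` ?R = f ` X" by (auto simp: image_image f_inv_into_f)
  show "X - ?R \<subseteq> X" by blast
  have "2 \<le> card (X \<inter> f -` {v})" if v: "v \<in> f ` X" for v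
  proof -
    obtain x where x: "x \<in> X" "f x = v" using v by blast
    then obtain y where y: "y \<in> X" "y \<noteq> x" "f y = v" using rep by metis
    have "card {x, y} \<le> card (X \<inter> f -` {v})"
      using x y \<open>finite X\<close> by (intro card_mono) auto
    then show ?thesis using y by simp
  qed
  then have "(\<Sum>v\<in>f ` X. 2) \<le> (\<Sum>v\<in>f ` X. card (X \<inter> f -` {v}))"
    by (rule sum_mono)
  also have "\<dots> = card (\<Union>v\<in>f ` X. X \<inter> f -` {v})"
    using \<open>finite X\<close> by (subst card_UN_disjoint) auto
  also have "(\<Union>v\<in>f ` X. X \<inter> f -` {v}) = X" by auto
  finally have "2 * card (f ` X) \<le> card X" by simp
  moreover have "card ?R \<le> card (f ` X)"
    using \<open>finite X\<close> by (intro card_image_le) simp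
  moreover have "card (X - ?R) = card X - card ?R"
    using RX \<open>finite X\<close> by (intro card_Diff_subset) (auto intro: finite_subset)
  ultimately show "card X \<le> 2 * card (X - ?R)" by linarith
  have "X - (X - ?R) = ?R" using RX by auto
  then show "f ` (X - ?R) \<subseteq> f ` (X - (X - ?R))"
    using fR by auto
qed

text \<open>These are the positions on \<open>F\<close> that cannot be set freely in favour of
  clause \<open>i\<close> when it is peeled off \<open>B\<close>, because their variable occurs
  again in \<open>B\<close>, possibly in clause \<open>i\<close> itself.\<close>

definition shared :: "(nat \<times> nat \<Rightarrow> lit) \<Rightarrow> nat \<Rightarrow> nat set \<Rightarrow> nat set \<Rightarrow> nat \<Rightarrow> nat set" where
  "shared v k F B i = {j. j < k \<and> var_of (v (i, j)) \<in> F \<and>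
     (\<exists>y\<in>B \<times> {..<k}. y \<noteq> (i, j) \<and> var_of (v y) = var_of (v (i, j)))}"

definition falsified :: "(nat \<times> nat \<Rightarrow> lit) \<Rightarrow> nat \<Rightarrow> nat set \<Rightarrow> assignment \<Rightarrow> nat \<Rightarrow> nat set" where
  "falsified v k F \<tau> i = {j. j < k \<and> var_of (v (i, j)) \<in> F \<and> \<not> lit_true \<tau> (v (i, j))}"

text \<open>Peel off a clause with few shared positions, orient the rest, and then set the variables
  private to the peeled clause in its favour.\<close>

lemma peel_orientation:
  assumes "finite M" "\<And>B. B \<subseteq> M \<Longrightarrow> B \<noteq> {} \<Longrightarrow> \<exists>i\<in>B. 64 * card (shared v k F B i) \<le> k"
  shows "\<exists>\<tau>. \<forall>i\<in>M. 64 * card (falsified v k F \<tau> i) \<le> k"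
  using assms
proof (induction M rule: finite_psubset_induct)
  case (psubset M)
  show ?case
  proof (cases "M = {}")
    case False
    then obtain i where i: "i \<in> M" "64 * card (shared v k F M i) \<le> k"
      using psubset.prems[of M] by auto
    have "\<exists>\<tau>. \<forall>i\<in>M - {i}. 64 * card (falsified v k F \<tau> i) \<le> k"
      using i(1) psubset.prems by (intro psubset.IH) auto
    then obtain \<tau> where \<tau>: "\<And>i'. i' \<in> M - {i} \<Longrightarrow> 64 * card (falsified v k F \<tau> i') \<le> k"
      by blast
    \<comment> \<open>Exclusiveness is required among all positions of \<open>M\<close>, those of
      clause \<open>i\<close> included. This makes \<open>j\<close> unique, so that the
      \<open>SOME\<close> below is determined, and ensures that the change from
      \<open>\<tau>\<close> to \<open>\<tau>'\<close> affects no literal of the other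
      clauses.\<close>
    define priv where "priv j x \<longleftrightarrow> j < k \<and> var_of (v (i, j)) = x \<and>
      (\<forall>y\<in>M \<times> {..<k}. var_of (v y) = x \<longrightarrow> y = (i, j))" for j x
    define \<tau>' where "\<tau>' x = (if \<exists>j. priv j x then v (i, SOME j. priv j x) = Pos x else \<tau> x)" for x
    have SOME: "(SOME j. priv j x) = j" if "priv j x" for j x
      using that i(1) by (intro some_equality) (auto simp: priv_def)
    have true: "lit_true \<tau>' (v (i, j))" if p: "priv j (var_of (v (i, j)))" for j
      using SOME[OF p] p by (cases "v (i, j)") (auto simp: \<tau>'_def)
    have "falsified v k F \<tau>' i \<subseteq> shared v k F M i"
    proof
      fix j assume "j \<in> falsified v k F \<tau>' i"
      then have j: "j < k" "var_of (v (i, j)) \<in> F" "\<not> priv j (var_of (v (i, j)))"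
        using true by (auto simp: falsified_def)
      then show "j \<in> shared v k F M i"
        unfolding shared_def priv_def by blast
    qed
    then have "card (falsified v k F \<tau>' i) \<le> card (shared v k F M i)"
      by (intro card_mono) (auto simp: shared_def)
    then have 1: "64 * card (falsified v k F \<tau>' i) \<le> k" using i(2) by linarith
    have 2: "falsified v k F \<tau>' i' = falsified v k F \<tau> i'" if i': "i' \<in> M - {i}" for i'
    proof -
      have "lit_true \<tau>' (v (i', j)) = lit_true \<tau> (v (i', j))" if "j < k" for j
      proof -
        have "\<not> priv j' (var_of (v (i', j)))" for j'
          using i' that by (auto simp: priv_def)
        then have "\<tau>' (var_of (v (i', j))) = \<tau> (var_of (v (i', j)))" by (simp add: \<tau>'_def)
        then show ?thesis by (cases "v (i', j)") auto
      qed
      then show ?thesis by (auto simp: falsified_def)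
    qed
    show ?thesis
    proof (intro exI ballI)
      fix i' assume "i' \<in> M"
      then show "64 * card (falsified v k F \<tau>' i') \<le> k"
        using 1 2[of i'] \<tau>[of i'] by (cases "i' = i") auto
    qed
  qed simp
qed

text \<open>Meant for one size \<open>b\<close> of order n: confining \<open>e * b\<close> positions
  to a fixed \<open>F\<close> is then unlikely enough to survive a union over all
  \<open>F\<close>.\<close>

definition crowded :: "nat \<Rightarrow> nat \<Rightarrow> nat \<Rightarrow> nat \<Rightarrow> nat set \<Rightarrow> (nat \<times> nat \<Rightarrow> lit) \<Rightarrow> bool" where
  "crowded k m e b F v \<longleftrightarrow> (\<exists>B Q. B \<subseteq> {..<m} \<and> card B = b \<and> Q \<subseteq> B \<times> {..<k} \<and> card Q = e * b \<and>
     (\<forall>x\<in>Q. var_of (v x) \<in> F))"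

text \<open>Replaces \<open>crowded\<close> for small clause sets. The variables in \<open>Q\<close>
  must recur at positions of \<open>B\<close> outside \<open>Q\<close>, so \<open>F\<close>
  disappears from the event and no union over \<open>F\<close> is needed.\<close>

definition repetitive :: "nat \<Rightarrow> nat \<Rightarrow> nat \<Rightarrow> nat \<Rightarrow> (nat \<times> nat \<Rightarrow> lit) \<Rightarrow> bool" where
  "repetitive k m e b v \<longleftrightarrow> (\<exists>B Q. B \<subseteq> {..<m} \<and> card B = b \<and> Q \<subseteq> B \<times> {..<k} \<and> card Q = e * b \<and>
     (\<forall>x\<in>Q. var_of (v x) \<in> (\<lambda>y. var_of (v y)) ` (B \<times> {..<k} - Q)))"

text \<open>If peeling gets stuck at \<open>B\<close>, every clause of \<open>B\<close> has at least
  k/64 \<ge> 2e shared positions. A large \<open>B\<close> then contains a crowded set of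
  \<open>b0\<close> clauses. In a small \<open>B\<close> half of the shared positions repeat
  variables of the other half, which leaves \<open>e\<close> per clause; this halving is why 128
  stands against the 64 of the conclusion.\<close>

lemma exists_orientation:
  assumes e: "128 * e \<le> k"
    and crowded: "\<not> crowded k m e b0 F v"
    and repetitive: "\<And>b. b > 0 \<Longrightarrow> b \<le> b0 \<Longrightarrow> \<not> repetitive k m e b v"
  shows "\<exists>\<tau>. \<forall>i\<in>{..<m}. 64 * card (falsified v k F \<tau> i) \<le> k"
proof (rule peel_orientation)
  fix B assume B: "B \<subseteq> {..<m}" "B \<noteq> {}"
  have finB: "finite B" using B finite_subset by blast
  show "\<exists>i\<in>B. 64 * card (shared v k F B i) \<le> k"
  proof (rule ccontr)
    assume "\<not> ?thesis"
    then have many: "k \<le> 64 * card (shared v k F B i)" if "i \<in> B" for i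
      using that by fastforce
    define X where "X B' = (SIGMA i:B'. shared v k F B i)" for B'
    have finX: "finite (X B')" and XB: "X B' \<subseteq> B' \<times> {..<k}" if "B' \<subseteq> B" for B'
      using that finB finite_subset
      by (auto simp: X_def shared_def intro!: finite_SigmaI)
    have cX: "2 * (e * card B') \<le> card (X B')" if B': "B' \<subseteq> B" for B'
    proof -
      have finB': "finite B'" using B' finB finite_subset by blast
      have "128 * e * card B' \<le> (\<Sum>i\<in>B'. k)" using e by simp
      also have "\<dots> \<le> (\<Sum>i\<in>B'. 64 * card (shared v k F B i))"
        using many B' by (intro sum_mono) auto
      also have "\<dots> = 64 * card (X B')"
        unfolding X_def using finB' by (subst card_SigmaI) (auto simp: shared_def sum_distrib_left)
      finally show ?thesis by linarith
    qed
    show False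
    proof (cases "card B \<le> b0")
      case False
      then obtain B' where B': "B' \<subseteq> B" "card B' = b0"
        using obtain_subset_with_card_n[of b0 B] by (metis nat_le_linear)
      \<comment> \<open>The partner of a shared position may lie outside \<open>B'\<close>. What
        survives the passage to the subset is that the variables lie in \<open>F\<close>, which is
        all that \<open>crowded\<close> asks.\<close>
      have "e * b0 \<le> card (X B')" using cX[OF B'(1)] B'(2) by simp
      then obtain Q where Q: "Q \<subseteq> X B'" "card Q = e * b0"
        using obtain_subset_with_card_n by metis
      have "\<forall>x\<in>Q. var_of (v x) \<in> F" using Q(1) by (auto simp: X_def shared_def)
      moreover have "Q \<subseteq> B' \<times> {..<k}" using Q(1) XB[OF B'(1)] by blast
      ultimately have "crowded k m e b0 F v"
        unfolding crowded_def using B B' Q by blast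
      then show False using crowded by simp
    next
      case True
      let ?f = "\<lambda>x. var_of (v x)"
      have "\<exists>Q\<subseteq>X B. card (X B) \<le> 2 * card Q \<and> ?f ` Q \<subseteq> ?f ` (X B - Q)"
      proof (rule half_repeats[OF finX[OF order_refl]])
        fix x assume "x \<in> X B"
        then obtain i j where x: "x = (i, j)" "i \<in> B" "j \<in> shared v k F B i"
          by (auto simp: X_def)
        then obtain i' j' where y: "i' \<in> B" "j' < k" "(i', j') \<noteq> (i, j)" "?f (i', j') = ?f (i, j)"
          by (auto simp: shared_def)
        \<comment> \<open>Sharing is symmetric: the partner carries the same variable, hence one in
          \<open>F\<close>, and has \<open>(i, j)\<close> as its own partner.\<close>
        have "j' \<in> shared v k F B i'"
          using x y unfolding shared_def by (auto intro!: bexI[of _ "(i, j)"])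
        then show "\<exists>y\<in>X B. y \<noteq> x \<and> ?f y = ?f x"
          using x y by (intro bexI[of _ "(i', j')"]) (auto simp: X_def)
      qed
      then obtain Q where Q: "Q \<subseteq> X B" "card (X B) \<le> 2 * card Q" "?f ` Q \<subseteq> ?f ` (X B - Q)"
        by blast
      have "e * card B \<le> card Q" using Q(2) cX[OF order_refl] by linarith
      then obtain Q' where Q': "Q' \<subseteq> Q" "card Q' = e * card B"
        using obtain_subset_with_card_n by metis
      have QB: "Q' \<subseteq> B \<times> {..<k}" using Q' Q XB[OF order_refl] by blast
      have "?f ` (X B - Q) \<subseteq> ?f ` (B \<times> {..<k} - Q')"
        using XB[OF order_refl] Q'(1) by (intro image_mono) blast
      then have "\<forall>x\<in>Q'. ?f x \<in> ?f ` (B \<times> {..<k} - Q')"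
        using Q(3) Q'(1) by blast
      then have "repetitive k m e (card B) v"
        unfolding repetitive_def using B(1) QB Q'(2) by blast
      moreover have "card B > 0" using B(2) finB by (simp add: card_gt_0_iff)
      ultimately show False using repetitive True by blast
    qed
  qed
qed simp

section \<open>Union bounds over clause sets and position sets\<close>

lemma prob_crowded_le:
  assumes "n > 0" and "finite F" "card F \<le> s"
  shows "measure_pmf.prob (random_k_cnf k n m) {\<Phi>. crowded k m e b F (lit_at \<Phi>)}
    \<le> (m choose b) * 2 ^ (k * b) * (s / n) ^ (e * b)"
proof -
  let ?W = "\<lambda>B. {Q. Q \<subseteq> B \<times> {..<k} \<and> card Q = e * b}"
  let ?S = "{B. B \<subseteq> {..<m} \<and> card B = b}"
  let ?A = "\<lambda>Q. {\<Phi>. \<forall>x\<in>Q. var_of (lit_at \<Phi> x) \<in> F}"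
  have "measure_pmf.prob (random_k_cnf k n m) (\<Union>B\<in>?S. \<Union>Q\<in>?W B. ?A Q)
      \<le> card ?S * (2 ^ (k * b) * (s / n) ^ (e * b))"
  proof (rule prob_UN_le)
    fix B assume B: "B \<in> ?S"
    then have finB: "finite B" using finite_subset by blast
    have "measure_pmf.prob (random_k_cnf k n m) (\<Union>Q\<in>?W B. ?A Q)
        \<le> card (?W B) * (s / n) ^ (e * b)"
    proof (rule prob_UN_le)
      show "finite (?W B)" using finB by simp
      fix Q assume Q: "Q \<in> ?W B"
      then have "Q \<subseteq> {..<m} \<times> {..<k}" using B by auto
      from prob_vars_confined_le[OF \<open>n > 0\<close> this, of "\<lambda>_. F" s]
      show "measure_pmf.prob (random_k_cnf k n m) (?A Q) \<le> (s / n) ^ (e * b)"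
        using Q assms by simp
    qed
    also have "card (?W B) \<le> card (Pow (B \<times> {..<k}))"
      using finB by (intro card_mono) auto
    also have "\<dots> = 2 ^ (k * b)" using finB B by (simp add: card_Pow mult.commute)
    finally show "measure_pmf.prob (random_k_cnf k n m) (\<Union>Q\<in>?W B. ?A Q)
        \<le> 2 ^ (k * b) * (s / n) ^ (e * b)"
      by (simp add: mult_right_mono)
  qed simp
  moreover have "{\<Phi>. crowded k m e b F (lit_at \<Phi>)} = (\<Union>B\<in>?S. \<Union>Q\<in>?W B. ?A Q)"
    by (auto simp: crowded_def)
  moreover have "card ?S = m choose b" using n_subsets[of "{..<m}" b] by simp
  ultimately show ?thesis by (simp add: mult.assoc)
qed

lemma prob_repetitive_le:
  assumes "n > 0"
  shows "measure_pmf.prob (random_k_cnf k n m) {\<Phi>. repetitive k m e b (lit_at \<Phi>)}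
    \<le> (m choose b) * 2 ^ (k * b) * (real (k * b) / n) ^ (e * b)"
proof -
  let ?W = "\<lambda>B. {Q. Q \<subseteq> B \<times> {..<k} \<and> card Q = e * b}"
  let ?S = "{B. B \<subseteq> {..<m} \<and> card B = b}"
  let ?A = "\<lambda>B Q. {\<Phi>. \<forall>x\<in>Q. var_of (lit_at \<Phi> x) \<in> (\<lambda>y. var_of (lit_at \<Phi> y)) ` (B \<times> {..<k} - Q)}"
  have "measure_pmf.prob (random_k_cnf k n m) (\<Union>B\<in>?S. \<Union>Q\<in>?W B. ?A B Q)
      \<le> card ?S * (2 ^ (k * b) * (real (k * b) / n) ^ (e * b))"
  proof (rule prob_UN_le)
    fix B assume B: "B \<in> ?S"
    then have finB: "finite B" using finite_subset by blast
    have "measure_pmf.prob (random_k_cnf k n m) (\<Union>Q\<in>?W B. ?A B Q)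
        \<le> card (?W B) * (real (k * b) / n) ^ (e * b)"
    proof (rule prob_UN_le)
      show "finite (?W B)" using finB by simp
      fix Q assume Q: "Q \<in> ?W B"
      then have QI: "Q \<subseteq> {..<m} \<times> {..<k}" using B by auto
      \<comment> \<open>Only positions outside \<open>Q\<close> are read, so once these are exposed
        the target is a fixed set of at most \<open>k * b\<close> variables.\<close>
      define V where "V \<psi> = (\<lambda>y. var_of (\<psi> y)) ` (B \<times> {..<k} - Q)" for \<psi> :: "nat \<times> nat \<Rightarrow> lit"
      have V: "finite (V \<psi>) \<and> card (V \<psi>) \<le> k * b" for \<psi>
      proof
        show "finite (V \<psi>)" using finB by (simp add: V_def)
        have "card (V \<psi>) \<le> card (B \<times> {..<k} - Q)"
          unfolding V_def using finB by (intro card_image_le) simp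
        also have "\<dots> \<le> card (B \<times> {..<k})"
          using finB by (intro card_mono) auto
        also have "\<dots> = k * b" using B by (auto simp: card_cartesian_product mult.commute)
        finally show "card (V \<psi>) \<le> k * b" .
      qed
      have V_eq: "V (restrict (lit_at \<Phi>) ({..<m} \<times> {..<k} - Q)) = V (lit_at \<Phi>)" for \<Phi>
        unfolding V_def using B by (intro image_cong) auto
      show "measure_pmf.prob (random_k_cnf k n m) (?A B Q) \<le> (real (k * b) / n) ^ (e * b)"
        using prob_vars_confined_le[OF \<open>n > 0\<close> QI, of V "k * b"] V Q
        unfolding V_eq unfolding V_def by simp
    qed
    also have "card (?W B) \<le> card (Pow (B \<times> {..<k}))"
      using finB by (intro card_mono) auto
    also have "\<dots> = 2 ^ (k * b)" using finB B by (simp add: card_Pow mult.commute)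
    finally show "measure_pmf.prob (random_k_cnf k n m) (\<Union>Q\<in>?W B. ?A B Q)
        \<le> 2 ^ (k * b) * (real (k * b) / n) ^ (e * b)"
      by (simp add: mult_right_mono)
  qed simp
  moreover have "{\<Phi>. repetitive k m e b (lit_at \<Phi>)} = (\<Union>B\<in>?S. \<Union>Q\<in>?W B. ?A B Q)"
    by (auto simp: repetitive_def)
  moreover have "card ?S = m choose b" using n_subsets[of "{..<m}" b] by simp
  ultimately show ?thesis by (simp add: mult.assoc)
qed

subsection \<open>The number of distinct selected clauses\<close>

lemma length_clause_k_cnfs: "\<Phi> \<in> k_cnfs k n m \<Longrightarrow> i < length \<Phi> \<Longrightarrow> length (\<Phi> ! i) = k"
  using nth_mem[of i \<Phi>] by (auto simp: k_cnfs_def k_clauses_def subset_iff)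

text \<open>A selection adds at most one new clause, so the count skips no value. Cutting the run
  there yields exactly \<open>s\<close> clauses, the size over which the union bound ranges.\<close>

lemma exists_prefix_card_touched:
  assumes "s \<le> card (touched p)"
  shows "\<exists>q. prefix q p \<and> card (touched q) = s"
  using assms
proof (induction p rule: rev_induct)
  case Nil
  then show ?case by (auto simp: touched_def)
next
  case (snoc x p)
  show ?case
  proof (cases "s \<le> card (touched p)")
    case True
    then show ?thesis using snoc.IH by (meson prefix_append prefix_order.trans prefix_prefix)
  next
    case False
    have "touched (p @ [x]) = insert (fst x) (touched p)" by (simp add: touched_def)
    then have "card (touched (p @ [x])) \<le> Suc (card (touched p))"
      by (simp add: card_insert_le_m1)
    then show ?thesis using False snoc.prems by (intro exI[of _ "p @ [x]"]) auto
  qed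
qed

text \<open>The witness data of a selected clause: the first one or two positions chosen in it,
  and the last one. The final choice determines which variable the clause protects, and two
  initial choices are enough to pay for the union bound over the last one.\<close>

definition clause_witnesses :: "nat \<Rightarrow> (nat list \<times> nat) set" where
  "clause_witnesses k = (\<lambda>j. ([j], j)) ` {..<k} \<union>
     (\<lambda>(j1, j2, l). ([j1, j2], l)) ` ({..<k} \<times> {..<k} \<times> {..<k})"

definition protected :: "cnf \<Rightarrow> nat set \<Rightarrow> (nat \<Rightarrow> nat list \<times> nat) \<Rightarrow> nat set" where
  "protected \<Phi> S d = (\<lambda>i. var_of (lit_at \<Phi> (i, snd (d i)))) ` S"

text \<open>Position \<open>snd (d i)\<close> is left free because it defines the protected set. A
  position in \<open>fst (d i)\<close> was flipped, so its variable is protected whatever its sign;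
  at any other position only a positive literal is constrained, since a negative one may be false
  without having been flipped.\<close>

definition witnessed :: "nat \<Rightarrow> nat set \<Rightarrow> (nat \<Rightarrow> nat list \<times> nat) \<Rightarrow> cnf \<Rightarrow> bool" where
  "witnessed k S d \<Phi> \<longleftrightarrow> (\<forall>i\<in>S. \<forall>j<k. j \<noteq> snd (d i) \<longrightarrow>
     (if j \<in> set (fst (d i)) then var_of (lit_at \<Phi> (i, j)) \<in> protected \<Phi> S d
      else \<forall>x. lit_at \<Phi> (i, j) = Pos x \<longrightarrow> x \<in> protected \<Phi> S d))"

lemma finite_clause_witnesses: "finite (clause_witnesses k)"
  by (simp add: clause_witnesses_def)

lemma clause_witnesses_bounds:
  "w \<in> clause_witnesses k \<Longrightarrow> set (fst w) \<subseteq> {..<k} \<and> snd w < k"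
  by (auto simp: clause_witnesses_def)

text \<open>The last positions refer to a prefix \<open>q\<close> of the run that touches exactly
  \<open>s\<close> clauses; by \<open>flipped_subset_last\<close> they protect all variables flipped
  in \<open>q\<close>. The initial positions in \<open>q\<close> are also initial in
  \<open>p\<close>, so the prefix condition can be stated for the whole run.\<close>

lemma exists_witness:
  assumes \<Phi>: "\<Phi> \<in> k_cnfs k n m" and legal: "legal \<Phi> (\<lambda>_. True) p" and s: "s \<le> card (touched p)"
  shows "\<exists>S d. S \<subseteq> {..<m} \<and> card S = s \<and> d \<in> S \<rightarrow>\<^sub>E clause_witnesses k \<and>
    witnessed k S d \<Phi> \<and> (\<forall>i\<in>S. prefix (fst (d i)) (touches p i))"
proof -
  obtain q r where q: "p = q @ r" "card (touched q) = s"
    using exists_prefix_card_touched[OF s] by (auto simp: prefix_def)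
  have legq: "legal \<Phi> (\<lambda>_. True) q" using legal by (simp add: q legal_append)
  define S where "S = touched q"
  define d where "d = (\<lambda>i\<in>S. (take 2 (touches q i), last (touches q i)))"
  have len: "length \<Phi> = m" using \<Phi> by (simp add: k_cnfs_def)
  have lenC: "length (\<Phi> ! i) = k" if "i < m" for i
    using length_clause_k_cnfs[OF \<Phi>] that by (simp add: len)
  have bounds: "i < m \<and> j < k" if "(i, j) \<in> set q" for i j
    using legal_bounds[OF legq that] by (auto simp: len lenC)
  have Sm: "S \<subseteq> {..<m}" using bounds by (force simp: S_def touched_def)
  have tk: "set (touches q i) \<subseteq> {..<k}" for i
    using bounds by (auto simp: set_touches)
  have dW: "d i \<in> clause_witnesses k" if "i \<in> S" for i
  proof -
    have ne: "touches q i \<noteq> []" using that by (simp add: touches_eq_Nil_iff S_def)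
    have lastk: "last (touches q i) < k" using tk[of i] ne last_in_set by blast
    show ?thesis
    proof (cases "touches q i" rule: remdups_adj.cases)
      case 1
      then show ?thesis using ne by simp
    next
      case (2 j)
      then show ?thesis using that tk[of i] by (auto simp: d_def clause_witnesses_def)
    next
      case (3 j1 j2 js)
      have "j1 < k" "j2 < k" using tk[of i] 3 by auto
      then have "([j1, j2], last (touches q i)) \<in> clause_witnesses k"
        using lastk by (force simp: clause_witnesses_def)
      then show ?thesis using that 3 by (simp add: d_def numeral_2_eq_2)
    qed
  qed
  have prot: "flipped \<Phi> q \<subseteq> protected \<Phi> S d"
    using flipped_subset_last[OF legq] by (simp add: protected_def S_def d_def)
  have pre: "prefix (fst (d i)) (touches p i)" if "i \<in> S" for i
    using that by (simp add: d_def touches_def q take_is_prefix prefix_prefix)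
  have "witnessed k S d \<Phi>"
    unfolding witnessed_def
  proof (intro ballI allI impI)
    fix i j assume i: "i \<in> S" and j: "j < k"
    have im: "i < m" using i Sm by auto
    have "var_of (lit_at \<Phi> (i, j)) \<in> flipped \<Phi> q" if "j \<in> set (fst (d i))"
    proof -
      have "j \<in> set (touches q i)" using that i by (auto simp: d_def dest: in_set_takeD)
      then have "(i, j) \<in> set q" by (simp add: set_touches)
      then show ?thesis unfolding flipped_def by (rule rev_image_eqI) simp
    qed
    moreover have "x \<in> flipped \<Phi> q" if "lit_at \<Phi> (i, j) = Pos x" for x
    proof -
      have "Pos x \<in> set (\<Phi> ! i)" using that j lenC[OF im] nth_mem[of j "\<Phi> ! i"] by simp
      then show ?thesis using legal_invariant[OF legq] i by (auto simp: S_def)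
    qed
    ultimately show "if j \<in> set (fst (d i)) then var_of (lit_at \<Phi> (i, j)) \<in> protected \<Phi> S d
        else \<forall>x. lit_at \<Phi> (i, j) = Pos x \<longrightarrow> x \<in> protected \<Phi> S d"
      using prot by auto
  qed
  moreover have "d \<in> S \<rightarrow>\<^sub>E clause_witnesses k"
    using dW by (auto simp: d_def)
  ultimately show ?thesis
    using Sm q(2) pre by (intro exI[of _ S] exI[of _ d]) (auto simp: S_def)
qed

lemma card_pos_restricted_le:
  assumes "finite V"
  shows "card ({l. \<forall>x. l = Pos x \<longrightarrow> x \<in> V} \<inter> literals n) \<le> n + card V"
proof -
  have "{l. \<forall>x. l = Pos x \<longrightarrow> x \<in> V} \<inter> literals n \<subseteq> Neg ` {1..n} \<union> Pos ` V"
    by (auto simp: literals_def)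
  then have "card ({l. \<forall>x. l = Pos x \<longrightarrow> x \<in> V} \<inter> literals n) \<le> card (Neg ` {1..n} \<union> Pos ` V)"
    using assms by (intro card_mono) auto
  also have "\<dots> \<le> card (Neg ` {1..n}) + card (Pos ` V)"
    by (rule card_Un_le)
  also have "\<dots> \<le> card {1..n} + card V"
    using assms by (intro add_mono card_image_le) auto
  finally show ?thesis by simp
qed

text \<open>Exposing the \<open>s\<close> last positions fixes the protected set. A further literal
  is then negative or protected with probability at most (n + s)/(2n) = \<open>a\<close>, and has a
  protected variable with probability at most s/n. As \<open>a\<close> is at least 1/2, the latter
  is at most \<open>a * u\<close>, which lets the \<open>a\<close> factors be collected uniformly
  over the k - 1 other positions.\<close>

lemma prob_witnessed_le:
  fixes s :: nat
  assumes "n > 0" and S: "S \<subseteq> {..<m}" "card S = s" and d: "d \<in> S \<rightarrow>\<^sub>E clause_witnesses k"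
  defines "a \<equiv> (1 + s / n) / 2" and "u \<equiv> 2 * (s / n)"
  shows "measure_pmf.prob (random_k_cnf k n m) {\<Phi>. witnessed k S d \<Phi>}
    \<le> (\<Prod>i\<in>S. a ^ (k - 1) * u ^ card (set (fst (d i)) - {snd (d i)}))"
proof -
  let ?I = "{..<m} \<times> {..<k}"
  define K where "K = (\<lambda>i. (i, snd (d i))) ` S"
  define V where "V \<psi> = (\<lambda>i. var_of (\<psi> (i, snd (d i)))) ` S" for \<psi> :: "nat \<times> nat \<Rightarrow> lit"
  define A where "A x \<psi> = (if fst x \<in> S
      then if snd x \<in> set (fst (d (fst x))) then {l. var_of l \<in> V \<psi>}
        else {l. \<forall>y. l = Pos y \<longrightarrow> y \<in> V \<psi>}
      else UNIV)" for x \<psi>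
  define c where "c x = (if fst x \<in> S then a * (if snd x \<in> set (fst (d (fst x))) then u else 1) else 1)"
    for x :: "nat \<times> nat"
  have finS: "finite S" using S finite_subset by blast
  have dW: "set (fst (d i)) \<subseteq> {..<k}" "snd (d i) < k" if "i \<in> S" for i
    using clause_witnesses_bounds[of "d i" k] d that by auto
  have K: "K \<subseteq> ?I" using S dW by (auto simp: K_def)
  have V: "finite (V \<psi>)" "card (V \<psi>) \<le> s" for \<psi>
    using finS S(2) card_image_le[OF finS] by (auto simp: V_def)
  have V_res: "V (restrict (lit_at \<Phi>) K) = V (lit_at \<Phi>)" for \<Phi>
    unfolding V_def by (intro image_cong) (auto simp: K_def)
  have u1: "a \<ge> 1 / 2" "u \<ge> 0" by (auto simp: a_def u_def)
  have "card (A x \<psi> \<inter> literals n) \<le> c x * (2 * n)" for x \<psi>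
  proof (cases "fst x \<in> S")
    case False
    then show ?thesis by (simp add: A_def c_def card_literals)
  next
    case True
    show ?thesis
    proof (cases "snd x \<in> set (fst (d (fst x)))")
      case in_g: True
      have "card (A x \<psi> \<inter> literals n) \<le> 2 * s"
        using card_literals_over_le[OF V(1), of \<psi> n] V(2)[of \<psi>] True in_g by (simp add: A_def)
      then have "real (card (A x \<psi> \<inter> literals n)) \<le> real (2 * s)" by (rule of_nat_mono)
      also have "\<dots> = 1 / 2 * u * (2 * n)" using \<open>n > 0\<close> by (simp add: u_def)
      also have "\<dots> \<le> a * u * (2 * n)" using u1 by (intro mult_right_mono) auto
      finally show ?thesis using True in_g by (simp add: c_def)
    next
      case False
      have "card (A x \<psi> \<inter> literals n) \<le> n + s"
        using card_pos_restricted_le[OF V(1), of \<psi> n] V(2)[of \<psi>] True False by (simp add: A_def)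
      then have "real (card (A x \<psi> \<inter> literals n)) \<le> real (n + s)" by (rule of_nat_mono)
      also have "\<dots> = a * (2 * n)" using \<open>n > 0\<close> by (simp add: a_def field_simps)
      finally show ?thesis using True False by (simp add: c_def)
    qed
  qed
  then have "measure_pmf.prob (random_k_cnf k n m)
      {\<Phi>. \<forall>x\<in>?I - K. lit_at \<Phi> x \<in> A x (restrict (lit_at \<Phi>) K)} \<le> (\<Prod>x\<in>?I - K. c x)"
    by (intro prob_random_k_cnf_le \<open>n > 0\<close> K) simp
  moreover have "{\<Phi>. witnessed k S d \<Phi>}
      \<subseteq> {\<Phi>. \<forall>x\<in>?I - K. lit_at \<Phi> x \<in> A x (restrict (lit_at \<Phi>) K)}"
  proof (intro subsetI CollectI ballI)
    fix \<Phi> x assume w: "\<Phi> \<in> {\<Phi>. witnessed k S d \<Phi>}" and x: "x \<in> ?I - K"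
    obtain i j where ij: "x = (i, j)" by force
    have "V (lit_at \<Phi>) = protected \<Phi> S d" by (simp add: V_def protected_def)
    moreover have "j \<noteq> snd (d i)" "j < k" if "i \<in> S"
      using x that by (auto simp: K_def ij)
    ultimately show "lit_at \<Phi> x \<in> A x (restrict (lit_at \<Phi>) K)"
      using w unfolding A_def V_res by (auto simp: witnessed_def ij split: if_splits)
  qed
  ultimately have "measure_pmf.prob (random_k_cnf k n m) {\<Phi>. witnessed k S d \<Phi>} \<le> (\<Prod>x\<in>?I - K. c x)"
    by (elim order_trans[rotated] measure_pmf.finite_measure_mono) simp
  also have "?I - K = (SIGMA i:{..<m}. {..<k} - (if i \<in> S then {snd (d i)} else {}))"
    using S by (auto simp: K_def split: if_splits)
  also have "(\<Prod>x\<in>\<dots>. c x) = (\<Prod>i<m. \<Prod>j\<in>{..<k} - (if i \<in> S then {snd (d i)} else {}). c (i, j))"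
    by (subst prod.Sigma) auto
  also have "\<dots> = (\<Prod>i\<in>S. \<Prod>j\<in>{..<k} - (if i \<in> S then {snd (d i)} else {}). c (i, j))"
    using S by (intro prod.mono_neutral_right) (auto simp: c_def)
  also have "\<dots> = (\<Prod>i\<in>S. a ^ (k - 1) * u ^ card (set (fst (d i)) - {snd (d i)}))"
  proof (rule prod.cong[OF refl])
    fix i assume i: "i \<in> S"
    have "(\<Prod>j\<in>{..<k} - {snd (d i)}. if j \<in> set (fst (d i)) then u else 1)
        = (\<Prod>j\<in>set (fst (d i)) - {snd (d i)}. u)"
      using dW(1)[OF i] by (intro prod.mono_neutral_cong_right) auto
    then show "(\<Prod>j\<in>{..<k} - (if i \<in> S then {snd (d i)} else {}). c (i, j))
        = a ^ (k - 1) * u ^ card (set (fst (d i)) - {snd (d i)})"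
      using i dW(2)[OF i] by (simp add: c_def prod.distrib)
  qed
  finally show ?thesis .
qed

text \<open>Clauses selected once contribute k * (1/k) = 1. For the others the weight k^-2 meets k^3
  triples, and with ku \<le> 2 the factors \<open>u\<close> reduce the total to (1 + 3ku + (ku)^2)/k
  \<le> (1 + 6 + 4)/k.\<close>

lemma sum_clause_witnesses_le:
  fixes u :: real
  assumes "k > 0" and u: "0 \<le> u" "u \<le> 2 / k"
  shows "(\<Sum>w\<in>clause_witnesses k. u ^ card (set (fst w) - {snd w}) * (1 / k) ^ length (fst w))
    \<le> 1 + 11 / k"
proof -
  let ?f = "\<lambda>w::nat list \<times> nat. u ^ card (set (fst w) - {snd w}) * (1 / k) ^ length (fst w)"
  let ?X = "(\<lambda>j. ([j], j)) ` {..<k} :: (nat list \<times> nat) set"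
  let ?Y = "(\<lambda>(j1, j2, l). ([j1, j2], l)) ` ({..<k} \<times> {..<k} \<times> {..<k}) :: (nat list \<times> nat) set"
  let ?T = "\<lambda>l j1 j2. u ^ card ({j1, j2} - {l})"
  have X: "sum ?f ?X = 1"
    using \<open>k > 0\<close> by (subst sum.reindex) (auto simp: inj_on_def)
  have "sum ?f ?Y = (\<Sum>(j1, j2, l)\<in>{..<k} \<times> {..<k} \<times> {..<k}. ?T l j1 j2 * (1 / k)\<^sup>2)"
    by (subst sum.reindex) (auto simp: inj_on_def numeral_2_eq_2 intro!: sum.cong)
  also have "\<dots> = (\<Sum>j1<k. \<Sum>j2<k. \<Sum>l<k. ?T l j1 j2 * (1 / k)\<^sup>2)"
    by (simp add: sum.cartesian_product)
  also have "\<dots> = (\<Sum>j1<k. \<Sum>l<k. \<Sum>j2<k. ?T l j1 j2 * (1 / k)\<^sup>2)"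
    by (rule sum.cong[OF refl]) (rule sum.swap)
  also have "\<dots> = (\<Sum>l<k. \<Sum>j1<k. \<Sum>j2<k. ?T l j1 j2 * (1 / k)\<^sup>2)"
    by (rule sum.swap)
  also have "\<dots> \<le> (\<Sum>l<k. (1 + 3 * (k * u) + (k * u)\<^sup>2) * (1 / k)\<^sup>2)"
  proof (rule sum_mono)
    fix l assume "l \<in> {..<k}"
    then have l: "l < k" by simp
    \<comment> \<open>Split by coincidences: no factor \<open>u\<close> if both positions equal
      \<open>l\<close>, one factor on each of the three lines j1 = l, j2 = l and j1 = j2, and two
      factors otherwise. Summation turns the three lines into the coefficient 3.\<close>
    have "?T l j1 j2 \<le> (if j1 = l then (if j2 = l then 1 else 0) + u else 0) +
        ((if j2 = j1 then u else 0) + (if j2 = l then u else 0) + u\<^sup>2)" for j1 j2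
    proof (cases "j1 = j2 \<or> j1 = l \<or> j2 = l")
      case True
      then show ?thesis using u by (auto simp: insert_Diff_if power2_eq_square)
    next
      case False
      then have "card ({j1, j2} - {l}) = 2" by (auto simp: insert_Diff_if)
      then show ?thesis using u by simp
    qed
    then have "(\<Sum>j1<k. \<Sum>j2<k. ?T l j1 j2) \<le> (\<Sum>j1<k. \<Sum>j2<k.
        (if j1 = l then (if j2 = l then 1 else 0) + u else 0) +
        ((if j2 = j1 then u else 0) + (if j2 = l then u else 0) + u\<^sup>2))"
      by (intro sum_mono)
    also have "\<dots> = (\<Sum>j1<k. (if j1 = l then 1 + k * u else 0) + (u + u + k * u\<^sup>2))"
    proof (rule sum.cong[OF refl])
      fix j1 assume "j1 \<in> {..<k}"
      then show "(\<Sum>j2<k. (if j1 = l then (if j2 = l then 1 else 0) + u else 0) +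
            ((if j2 = j1 then u else 0) + (if j2 = l then u else 0) + u\<^sup>2))
          = (if j1 = l then 1 + k * u else 0) + (u + u + k * u\<^sup>2)"
        using l by (simp add: sum.distrib)
    qed
    also have "\<dots> = 1 + 3 * (k * u) + (k * u)\<^sup>2"
      using l by (simp add: sum.distrib algebra_simps power2_eq_square)
    finally have "(\<Sum>j1<k. \<Sum>j2<k. ?T l j1 j2) * (1 / k)\<^sup>2 \<le> (1 + 3 * (k * u) + (k * u)\<^sup>2) * (1 / k)\<^sup>2"
      by (rule mult_right_mono) simp
    then show "(\<Sum>j1<k. \<Sum>j2<k. ?T l j1 j2 * (1 / k)\<^sup>2) \<le> (1 + 3 * (k * u) + (k * u)\<^sup>2) * (1 / k)\<^sup>2"
      by (simp add: sum_distrib_right)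
  qed
  also have "\<dots> = (1 + 3 * (k * u) + (k * u)\<^sup>2) / k"
    using \<open>k > 0\<close> by (simp add: power2_eq_square)
  also have "\<dots> \<le> 11 / k"
  proof (rule divide_right_mono)
    have "k * u \<le> 2" using u \<open>k > 0\<close> by (simp add: field_simps)
    moreover from this have "(k * u)\<^sup>2 \<le> 2\<^sup>2" using u by (intro power_mono) auto
    ultimately show "1 + 3 * (k * u) + (k * u)\<^sup>2 \<le> 11" by simp
  qed simp
  finally have Y: "sum ?f ?Y \<le> 11 / k" .
  have "sum ?f (clause_witnesses k) = sum ?f ?X + sum ?f ?Y"
    unfolding clause_witnesses_def by (rule sum.union_disjoint) auto
  then show ?thesis using X Y by simp
qed

lemma integrable_random_k_cnf [simp]:
  fixes f :: "cnf \<Rightarrow> real"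
  assumes "n > 0"
  shows "integrable (measure_pmf (random_k_cnf k n m)) f"
  using assms unfolding random_k_cnf_def
  by (intro integrable_measure_pmf_finite) (simp add: finite_k_cnfs k_cnfs_nonempty)

lemma set_random_k_cnf: "n > 0 \<Longrightarrow> set_pmf (random_k_cnf k n m) = k_cnfs k n m"
  unfolding random_k_cnf_def by (simp add: finite_k_cnfs k_cnfs_nonempty)

text \<open>For a fixed formula and fixed witness data, whether the data fit the formula is
  deterministic, and the walk contributes only the position weights \<open>W\<close>. Averaging over
  the formula then brings in \<open>prob_witnessed_le\<close>. Both bounds are products over the
  clauses of \<open>S\<close>, so the sum over \<open>d\<close> factorises into one witness sum per
  clause.\<close>

lemma expectation_many_touched_le:
  fixes s :: nat
  assumes "n > 0" "k > 0" and s: "k * s \<le> n"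
  shows "measure_pmf.expectation (random_k_cnf k n m)
      (\<lambda>\<Phi>. measure_pmf.prob (walk_trace \<Phi> t (\<lambda>_. True)) {p. s \<le> card (touched p)})
    \<le> (m choose s) * (((1 + s / n) / 2) ^ (k - 1) * (1 + 11 / k)) ^ s"
proof -
  define a where "a = (1 + s / n) / 2"
  define u where "u = 2 * (real s / n)"
  define \<S> where "\<S> = {S. S \<subseteq> {..<m} \<and> card S = s}"
  define \<D> where "\<D> S = S \<rightarrow>\<^sub>E clause_witnesses k" for S :: "nat set"
  define W where "W S d = (\<Prod>i\<in>S. (1 / real k) ^ length (fst (d i)))"
    for S :: "nat set" and d :: "nat \<Rightarrow> nat list \<times> nat"
  let ?M = "random_k_cnf k n m"
  let ?pr = "\<lambda>\<Phi>. measure_pmf.prob (walk_trace \<Phi> t (\<lambda>_. True))"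
  have fin\<S>: "finite \<S>" by (simp add: \<S>_def)
  have finS: "finite S" if "S \<in> \<S>" for S using that finite_subset by (auto simp: \<S>_def)
  have fin\<D>: "finite (\<D> S)" if "S \<in> \<S>" for S
    using finS[OF that] unfolding \<D>_def by (intro finite_PiE) (auto simp: finite_clause_witnesses)
  have W0: "W S d \<ge> 0" for S d unfolding W_def by (intro prod_nonneg) auto
  have a0: "a \<ge> 0" and u0: "u \<ge> 0" by (auto simp: a_def u_def)
  have pointwise: "?pr \<Phi> {p. s \<le> card (touched p)}
      \<le> (\<Sum>S\<in>\<S>. \<Sum>d\<in>\<D> S. indicator {\<Phi>. witnessed k S d \<Phi>} \<Phi> * W S d)"
    if \<Phi>: "\<Phi> \<in> k_cnfs k n m" for \<Phi>
  proof -
    note len = length_clause_k_cnfs[OF \<Phi>]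
    let ?E = "\<lambda>S d. {p. witnessed k S d \<Phi> \<and> (\<forall>i\<in>S. prefix (fst (d i)) (touches p i))}"
    have "?pr \<Phi> {p. s \<le> card (touched p)} \<le> ?pr \<Phi> (\<Union>S\<in>\<S>. \<Union>d\<in>\<D> S. ?E S d)"
    proof (rule measure_pmf.finite_measure_mono_AE)
      show "AE p in measure_pmf (walk_trace \<Phi> t (\<lambda>_. True)).
          p \<in> {p. s \<le> card (touched p)} \<longrightarrow> p \<in> (\<Union>S\<in>\<S>. \<Union>d\<in>\<D> S. ?E S d)"
      proof (intro AE_pmfI impI)
        fix p assume p: "p \<in> set_pmf (walk_trace \<Phi> t (\<lambda>_. True))" "p \<in> {p. s \<le> card (touched p)}"
        have "legal \<Phi> (\<lambda>_. True) p"
          by (rule legal_walk_trace[OF _ p(1)]) (use len \<open>k > 0\<close> in auto)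
        from exists_witness[OF \<Phi> this, of s] p(2)
        show "p \<in> (\<Union>S\<in>\<S>. \<Union>d\<in>\<D> S. ?E S d)"
          unfolding \<S>_def \<D>_def by blast
      qed
    qed simp
    also have "\<dots> \<le> (\<Sum>S\<in>\<S>. ?pr \<Phi> (\<Union>d\<in>\<D> S. ?E S d))"
      by (rule measure_UNION_le[OF fin\<S>]) simp
    also have "\<dots> \<le> (\<Sum>S\<in>\<S>. \<Sum>d\<in>\<D> S. ?pr \<Phi> (?E S d))"
      by (intro sum_mono measure_UNION_le fin\<D>) auto
    also have "\<dots> \<le> (\<Sum>S\<in>\<S>. \<Sum>d\<in>\<D> S. indicator {\<Phi>. witnessed k S d \<Phi>} \<Phi> * W S d)"
    proof (intro sum_mono)
      fix S d assume S: "S \<in> \<S>"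
      show "?pr \<Phi> (?E S d) \<le> indicator {\<Phi>. witnessed k S d \<Phi>} \<Phi> * W S d"
        using prob_touches_prefix_le[OF len \<open>k > 0\<close> finS[OF S], of t "\<lambda>_. True" "\<lambda>i. fst (d i)"]
        by (cases "witnessed k S d \<Phi>") (simp_all add: W_def)
    qed
    finally show ?thesis .
  qed
  have "measure_pmf.expectation ?M (\<lambda>\<Phi>. ?pr \<Phi> {p. s \<le> card (touched p)})
      \<le> measure_pmf.expectation ?M (\<lambda>\<Phi>. \<Sum>S\<in>\<S>. \<Sum>d\<in>\<D> S. indicator {\<Phi>. witnessed k S d \<Phi>} \<Phi> * W S d)"
    using pointwise \<open>n > 0\<close>
    by (intro integral_mono_AE AE_pmfI) (auto simp: set_random_k_cnf)
  also have "\<dots> = (\<Sum>S\<in>\<S>. \<Sum>d\<in>\<D> S. measure_pmf.prob ?M {\<Phi>. witnessed k S d \<Phi>} * W S d)"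
    using \<open>n > 0\<close> by (simp add: Bochner_Integration.integral_sum)
  also have "\<dots> \<le> (\<Sum>S\<in>\<S>. \<Sum>d\<in>\<D> S. \<Prod>i\<in>S. a ^ (k - 1) *
      (u ^ card (set (fst (d i)) - {snd (d i)}) * (1 / k) ^ length (fst (d i))))"
  proof (intro sum_mono)
    fix S d assume S: "S \<in> \<S>" and d: "d \<in> \<D> S"
    have "measure_pmf.prob ?M {\<Phi>. witnessed k S d \<Phi>}
        \<le> (\<Prod>i\<in>S. a ^ (k - 1) * u ^ card (set (fst (d i)) - {snd (d i)}))"
      using prob_witnessed_le[OF \<open>n > 0\<close>, of S m s d k] S d by (simp add: \<S>_def \<D>_def a_def u_def)
    from mult_right_mono[OF this W0[of S d]]
    show "measure_pmf.prob ?M {\<Phi>. witnessed k S d \<Phi>} * W S d \<le> (\<Prod>i\<in>S. a ^ (k - 1) *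
        (u ^ card (set (fst (d i)) - {snd (d i)}) * (1 / k) ^ length (fst (d i))))"
      by (simp add: W_def prod.distrib mult.assoc)
  qed
  also have "\<dots> = (\<Sum>S\<in>\<S>. \<Prod>i\<in>S. \<Sum>w\<in>clause_witnesses k. a ^ (k - 1) *
      (u ^ card (set (fst w) - {snd w}) * (1 / k) ^ length (fst w)))"
    unfolding \<D>_def using finS
    by (intro sum.cong refl prod_sum_PiE[symmetric]) (auto simp: finite_clause_witnesses)
  also have "\<dots> \<le> (\<Sum>S\<in>\<S>. \<Prod>i\<in>S. a ^ (k - 1) * (1 + 11 / k))"
  proof (intro sum_mono prod_mono conjI)
    show "0 \<le> (\<Sum>w\<in>clause_witnesses k. a ^ (k - 1) *
      (u ^ card (set (fst w) - {snd w}) * (1 / k) ^ length (fst w)))"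
      using a0 u0 by (intro sum_nonneg) auto
    have "real (k * s) \<le> real n" using s by (rule of_nat_mono)
    then have "u \<le> 2 / k" using \<open>n > 0\<close> \<open>k > 0\<close> by (simp add: u_def field_simps)
    from sum_clause_witnesses_le[OF \<open>k > 0\<close> u0 this] a0
    show "(\<Sum>w\<in>clause_witnesses k. a ^ (k - 1) *
      (u ^ card (set (fst w) - {snd w}) * (1 / k) ^ length (fst w))) \<le> a ^ (k - 1) * (1 + 11 / k)"
      unfolding sum_distrib_left[symmetric] by (intro mult_left_mono) auto
  qed
  also have "\<dots> = card \<S> * (a ^ (k - 1) * (1 + 11 / k)) ^ s"
    by (simp add: \<S>_def)
  also have "card \<S> = m choose s"
    using n_subsets[of "{..<m}" s] by (simp add: \<S>_def)
  finally show ?thesis by (simp add: a_def)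
qed

subsection \<open>The failure probability\<close>

lemma prob_confined_few_touched_le:
  assumes "n > 0" "k > 0" and \<Phi>: "\<Phi> \<in> k_cnfs k n m"
    and e: "128 * e \<le> k"
    and crowded: "\<And>F. F \<subseteq> {1..n} \<Longrightarrow> card F \<le> s \<Longrightarrow> \<not> crowded k m e b0 F (lit_at \<Phi>)"
    and repetitive: "\<And>b. b > 0 \<Longrightarrow> b \<le> b0 \<Longrightarrow> \<not> repetitive k m e b (lit_at \<Phi>)"
  shows "measure_pmf.prob (walk_trace \<Phi> t (\<lambda>_. True)) {p. length p = t \<and> card (touched p) \<le> s}
    \<le> 2 ^ n * 8 ^ s / 4 ^ t"
proof -
  let ?pr = "measure_pmf.prob (walk_trace \<Phi> t (\<lambda>_. True))"
  let ?\<F> = "{F. F \<subseteq> {1..n} \<and> card F \<le> s}"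
  let ?E = "\<lambda>F. {p. length p = t \<and> flipped \<Phi> p \<subseteq> F}"
  note len = length_clause_k_cnfs[OF \<Phi>]
  have lm: "length \<Phi> = m" using \<Phi> by (simp add: k_cnfs_def)
  have "?pr {p. length p = t \<and> card (touched p) \<le> s} \<le> ?pr (\<Union>F\<in>?\<F>. ?E F)"
  proof (rule measure_pmf.finite_measure_mono_AE)
    show "AE p in measure_pmf (walk_trace \<Phi> t (\<lambda>_. True)).
        p \<in> {p. length p = t \<and> card (touched p) \<le> s} \<longrightarrow> p \<in> (\<Union>F\<in>?\<F>. ?E F)"
    proof (intro AE_pmfI impI)
      fix p assume p: "p \<in> set_pmf (walk_trace \<Phi> t (\<lambda>_. True))"
        "p \<in> {p. length p = t \<and> card (touched p) \<le> s}"
      have legal: "legal \<Phi> (\<lambda>_. True) p"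
        by (rule legal_walk_trace[OF _ p(1)]) (use len \<open>k > 0\<close> in auto)
      have "var_of (lit_at \<Phi> x) \<in> {1..n}" if x: "x \<in> set p" for x
      proof -
        obtain i j where ij: "x = (i, j)" by force
        have "x \<in> {..<m} \<times> {..<k}"
          using legal_bounds[OF legal, of i j] x len[of i] by (auto simp: lm ij)
        from lit_at_in_literals[OF \<Phi> this] show ?thesis by (auto simp: literals_def)
      qed
      then have "flipped \<Phi> p \<subseteq> {1..n}" by (auto simp: flipped_def)
      moreover have "card (flipped \<Phi> p) \<le> s"
        using card_flipped_le[OF legal] p(2) by simp
      ultimately show "p \<in> (\<Union>F\<in>?\<F>. ?E F)" using p(2) by auto
    qed
  qed simp
  also have "\<dots> \<le> card ?\<F> * (8 ^ s / 4 ^ t)"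
  proof (rule prob_UN_le)
    fix F assume F: "F \<in> ?\<F>"
    then have finF: "finite F" using finite_subset by blast
    from exists_orientation[OF e, of m b0 F "lit_at \<Phi>"] crowded[of F] repetitive F
    obtain \<tau> where \<tau>: "\<forall>i\<in>{..<m}. 64 * card (falsified (lit_at \<Phi>) k F \<tau> i) \<le> k" by blast
    have "?pr (?E F) \<le> 8 ^ card {x\<in>F. True \<noteq> \<tau> x} / 4 ^ t"
      by (rule prob_confined_walk_le[OF len \<open>k > 0\<close> finF])
        (use \<tau> in \<open>auto simp: falsified_def lm\<close>)
    also have "card {x\<in>F. True \<noteq> \<tau> x} \<le> card F"
      using finF by (intro card_mono) auto
    then have "(8::real) ^ card {x\<in>F. True \<noteq> \<tau> x} / 4 ^ t \<le> 8 ^ s / 4 ^ t"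
      using F by (intro divide_right_mono power_increasing) auto
    finally show "?pr (?E F) \<le> 8 ^ s / 4 ^ t" .
  qed simp
  also have "card ?\<F> \<le> card (Pow {1..n})"
    by (intro card_mono) auto
  then have "real (card ?\<F>) \<le> real (2 ^ n)" by (intro of_nat_mono) (simp add: card_Pow)
  then have "real (card ?\<F>) \<le> 2 ^ n" by simp
  then have "card ?\<F> * (8 ^ s / 4 ^ t) \<le> 2 ^ n * (8 ^ s / 4 ^ t :: real)"
    by (rule mult_right_mono) simp
  finally show ?thesis by simp
qed

text \<open>The terms stand for runs touching \<open>s\<close> clauses, formulas crowded for one of
  at most 2^n sets \<open>F\<close>, formulas with a small repetitive set, and confined walks on all
  remaining formulas. On exceptional formulas the failure probability is simply bounded by
  1.\<close>

lemma expectation_failure_le: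
  fixes s :: nat
  assumes "n > 0" "k > 0" and s: "k * s \<le> n" and e: "128 * e \<le> k"
  shows "measure_pmf.expectation (random_k_cnf k n m)
      (\<lambda>\<Phi>. measure_pmf.prob (walk_trace \<Phi> t (\<lambda>_. True)) {p. length p = t})
    \<le> (m choose s) * (((1 + s / n) / 2) ^ (k - 1) * (1 + 11 / k)) ^ s
      + 2 ^ n * ((m choose b0) * 2 ^ (k * b0) * (s / n) ^ (e * b0))
      + (\<Sum>b\<in>{1..b0}. (m choose b) * 2 ^ (k * b) * (real (k * b) / n) ^ (e * b))
      + 2 ^ n * 8 ^ s / 4 ^ t"
proof -
  let ?M = "random_k_cnf k n m"
  let ?pr = "\<lambda>\<Phi>. measure_pmf.prob (walk_trace \<Phi> t (\<lambda>_. True))"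
  let ?\<F> = "{F. F \<subseteq> {1..n} \<and> card F \<le> s}"
  define A1 where "A1 = (\<Union>F\<in>?\<F>. {\<Phi>. crowded k m e b0 F (lit_at \<Phi>)})"
  define A2 where "A2 = (\<Union>b\<in>{1..b0}. {\<Phi>. repetitive k m e b (lit_at \<Phi>)})"
  define c where "c = 2 ^ n * 8 ^ s / (4::real) ^ t"
  have c0: "c \<ge> 0" by (simp add: c_def)
  have pointwise: "?pr \<Phi> {p. length p = t}
      \<le> ?pr \<Phi> {p. s \<le> card (touched p)} + indicator A1 \<Phi> + indicator A2 \<Phi> + c"
    if \<Phi>: "\<Phi> \<in> k_cnfs k n m" for \<Phi>
  proof (cases "\<Phi> \<in> A1 \<or> \<Phi> \<in> A2")
    case True
    have "?pr \<Phi> {p. length p = t} \<le> 1" "?pr \<Phi> {p. s \<le> card (touched p)} \<ge> 0" by simp_all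
    moreover have "indicator A1 \<Phi> + indicator A2 \<Phi> \<ge> (1::real)"
      using True by (auto simp: indicator_def)
    ultimately show ?thesis using c0 by linarith
  next
    case False
    have "?pr \<Phi> {p. length p = t}
        \<le> ?pr \<Phi> ({p. s \<le> card (touched p)} \<union> {p. length p = t \<and> card (touched p) \<le> s})"
      by (intro measure_pmf.finite_measure_mono) auto
    also have "\<dots> \<le> ?pr \<Phi> {p. s \<le> card (touched p)}
        + ?pr \<Phi> {p. length p = t \<and> card (touched p) \<le> s}"
      by (rule measure_Un_le) auto
    also have "?pr \<Phi> {p. length p = t \<and> card (touched p) \<le> s} \<le> c"
      unfolding c_def
    proof (rule prob_confined_few_touched_le[OF \<open>n > 0\<close> \<open>k > 0\<close> \<Phi> e])
      show "\<not> crowded k m e b0 F (lit_at \<Phi>)" if "F \<subseteq> {1..n}" "card F \<le> s" for F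
        using False that by (auto simp: A1_def)
      show "\<not> repetitive k m e b (lit_at \<Phi>)" if "b > 0" "b \<le> b0" for b
        using False that by (auto simp: A2_def)
    qed
    finally show ?thesis using False by simp
  qed
  have "measure_pmf.expectation ?M (\<lambda>\<Phi>. ?pr \<Phi> {p. length p = t})
      \<le> measure_pmf.expectation ?M (\<lambda>\<Phi>. ?pr \<Phi> {p. s \<le> card (touched p)}
          + indicator A1 \<Phi> + indicator A2 \<Phi> + c)"
    using pointwise \<open>n > 0\<close> by (intro integral_mono_AE AE_pmfI) (auto simp: set_random_k_cnf)
  also have "\<dots> = measure_pmf.expectation ?M (\<lambda>\<Phi>. ?pr \<Phi> {p. s \<le> card (touched p)})
      + measure_pmf.prob ?M A1 + measure_pmf.prob ?M A2 + c"
    using \<open>n > 0\<close> by simp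
  also have "measure_pmf.expectation ?M (\<lambda>\<Phi>. ?pr \<Phi> {p. s \<le> card (touched p)})
      \<le> (m choose s) * (((1 + s / n) / 2) ^ (k - 1) * (1 + 11 / k)) ^ s"
    by (rule expectation_many_touched_le[OF \<open>n > 0\<close> \<open>k > 0\<close> s])
  also have "measure_pmf.prob ?M A1 \<le> 2 ^ n * ((m choose b0) * 2 ^ (k * b0) * (s / n) ^ (e * b0))"
  proof -
    have "measure_pmf.prob ?M A1 \<le> card ?\<F> * ((m choose b0) * 2 ^ (k * b0) * (s / n) ^ (e * b0))"
      unfolding A1_def
    proof (rule prob_UN_le)
      fix F assume "F \<in> ?\<F>"
      then show "measure_pmf.prob ?M {\<Phi>. crowded k m e b0 F (lit_at \<Phi>)}
          \<le> (m choose b0) * 2 ^ (k * b0) * (s / n) ^ (e * b0)"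
        by (intro prob_crowded_le \<open>n > 0\<close>) (auto intro: finite_subset)
    qed simp
    also have "card ?\<F> \<le> card (Pow {1..n})"
      by (intro card_mono) auto
    then have "real (card ?\<F>) \<le> real (2 ^ n)" by (intro of_nat_mono) (simp add: card_Pow)
  then have "real (card ?\<F>) \<le> 2 ^ n" by simp
    then have "card ?\<F> * ((m choose b0) * 2 ^ (k * b0) * (s / n) ^ (e * b0))
        \<le> 2 ^ n * ((m choose b0) * 2 ^ (k * b0) * (s / n) ^ (e * b0))"
      by (rule mult_right_mono) simp
    finally show ?thesis .
  qed
  also have "measure_pmf.prob ?M A2
      \<le> (\<Sum>b\<in>{1..b0}. (m choose b) * 2 ^ (k * b) * (real (k * b) / n) ^ (e * b))"
  proof -
    have "measure_pmf.prob ?M A2 \<le> (\<Sum>b\<in>{1..b0}. measure_pmf.prob ?M {\<Phi>. repetitive k m e b (lit_at \<Phi>)})"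
      unfolding A2_def by (rule measure_UNION_le) auto
    also have "\<dots> \<le> (\<Sum>b\<in>{1..b0}. (m choose b) * 2 ^ (k * b) * (real (k * b) / n) ^ (e * b))"
      by (intro sum_mono prob_repetitive_le \<open>n > 0\<close>)
    finally show ?thesis .
  qed
  finally show ?thesis by (simp add: c_def)
qed

section \<open>Elementary estimates for the error terms\<close>

lemma power_div_fact_le_three_power: "real n ^ b / fact b \<le> 3 ^ n"
proof -
  let ?x = "real n"
  \<comment> \<open>The left side is a single term of the exponential series at n.\<close>
  have "(\<Sum>i\<in>{b}. ?x ^ i /\<^sub>R fact i) \<le> (\<Sum>i. ?x ^ i /\<^sub>R fact i)"
    by (intro sum_le_suminf summable_exp_generic) auto
  then have "?x ^ b / fact b \<le> exp ?x" by (simp add: exp_def divide_inverse mult.commute)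
  also have "\<dots> = exp 1 ^ n" by (simp flip: exp_of_nat_mult)
  also have "\<dots> \<le> 3 ^ n" using exp_le by (intro power_mono) auto
  finally show ?thesis .
qed

lemma choose_le_power_div_fact: "real (m choose b) \<le> real m ^ b / fact b"
proof -
  have "real ((m choose b) * fact b) \<le> real (m ^ b)"
    using binomial_fact_pow[of m b] by (rule of_nat_mono)
  then show ?thesis by (simp add: field_simps)
qed

lemma choose_le_three_power:
  assumes "b > 0"
  shows "real (m choose b) \<le> (3 * (m / b)) ^ b"
proof -
  have "real (m choose b) \<le> (m / b) ^ b * (real b ^ b / fact b)"
    using choose_le_power_div_fact[of m b] assms by (simp add: power_divide)
  also have "\<dots> \<le> (m / b) ^ b * 3 ^ b"
    by (intro mult_left_mono power_div_fact_le_three_power) auto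
  finally show ?thesis
    by (simp add: power_mult_distrib power_divide mult.commute)
qed

text \<open>With 3 for e, the factor per clause is 3 * 0.042 * 6 * 1.11, about 0.84. The 6 comes
  from (1 + 1/k)^(k-1) \<le> 3 over 2^(k-1), the 1.11 from 11/k \<le> 0.11, and 0.042 exceeds 1/25
  by enough to absorb the rounding in \<open>n div k\<close> and in \<open>m\<close> when
  \<open>s\<close> is at least 100.\<close>

lemma many_touched_bound:
  fixes k n m :: nat
  assumes k: "k \<ge> 100" and s: "s = n div k" "s \<ge> 100"
    and m: "real m \<le> 2 ^ k * n / (25 * k) + 1"
  shows "(m choose s) * (((1 + s / n) / 2) ^ (k - 1) * (1 + 11 / k)) ^ s \<le> (9 / 10) ^ s"
proof -
  have ks: "k * s \<le> n" "n < k * (s + 1)"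
    using k by (auto simp: s(1) dividend_less_times_div)
  have n0: "n > 0" using ks(1) k s(2) by (metis gr0I le_zero_eq mult_eq_0_iff not_numeral_le_zero)
  have "real (k * s) \<le> real n" using ks(1) by (rule of_nat_mono)
  then have f: "s / n \<le> 1 / k" using n0 k by (simp add: field_simps)
  have "(1 + s / n) ^ (k - 1) \<le> (1 + 1 / k) ^ (k - 1)"
    using f by (intro power_mono) auto
  also have "\<dots> \<le> (1 + 1 / k) ^ k"
    by (intro power_increasing) auto
  also have "\<dots> \<le> exp 1"
    using k exp_ge_one_plus_x_over_n_power_n[of k 1] by simp
  also have "\<dots> \<le> 3" by (rule exp_le)
  finally have "(1 + s / n) ^ (k - 1) / 2 ^ (k - 1) \<le> 3 / 2 ^ (k - 1)"
    by (rule divide_right_mono) simp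
  moreover have "3 / (2::real) ^ (k - 1) = 6 / 2 ^ k"
    using k by (cases k) auto
  ultimately have a: "((1 + s / n) / 2) ^ (k - 1) \<le> 6 / 2 ^ k"
    by (simp add: power_divide)
  have k11: "1 + 11 / k \<le> 111 / 100" using k by (simp add: field_simps)
  have "((1 + s / n) / 2) ^ (k - 1) * (1 + 11 / k) \<le> 6 / 2 ^ k * (111 / 100)"
    using a k11 by (intro mult_mono) auto
  then have a': "(((1 + s / n) / 2) ^ (k - 1) * (1 + 11 / k)) ^ s \<le> (6 / 2 ^ k * (111 / 100)) ^ s"
    by (intro power_mono) auto
  have "real n \<le> real (k * (s + 1))" using ks(2) by (intro of_nat_mono) simp
  then have "real n / k \<le> s + 1" using k by (simp add: field_simps)
  then have "2 ^ k / 25 * (real n / k) \<le> 2 ^ k / 25 * (s + 1)"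
    by (intro mult_left_mono) auto
  then have "real m \<le> 2 ^ k / 25 * (s + 1) + 1" using m by simp
  moreover have "(2::real) ^ 10 \<le> 2 ^ k" using k by (intro power_increasing) auto
  ultimately have "real m \<le> 2 ^ k / 25 * (s + 1) + 2 ^ k / 1000" by simp
  also have "\<dots> \<le> 2 ^ k * (42 / 1000 * s)"
  proof -
    have "(real s + 1) / 25 + 1 / 1000 \<le> 42 / 1000 * s"
    proof -
      have "real s \<ge> 100" using s(2) by simp
      moreover have "(real s + 1) / 25 = real s / 25 + 1 / 25" by (rule add_divide_distrib)
      ultimately show ?thesis by linarith
    qed
    from mult_left_mono[OF this, of "2 ^ k"] show ?thesis by (simp add: field_simps)
  qed
  finally have "m / s \<le> 2 ^ k * (42 / 1000)" using s(2) by (simp add: field_simps)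
  then have "(3 * (m / s)) ^ s \<le> (3 * (2 ^ k * (42 / 1000))) ^ s"
    by (intro power_mono mult_left_mono) auto
  then have c: "real (m choose s) \<le> (3 * (2 ^ k * (42 / 1000))) ^ s"
    using choose_le_three_power[of s m] s(2) by linarith
  have "(m choose s) * (((1 + s / n) / 2) ^ (k - 1) * (1 + 11 / k)) ^ s
      \<le> (3 * (2 ^ k * (42 / 1000))) ^ s * (6 / 2 ^ k * (111 / 100)) ^ s"
    using c a' by (intro mult_mono) auto
  also have "\<dots> = ((3 * (2 ^ k * (42 / 1000))) * (6 / 2 ^ k * (111 / 100))) ^ s"
    by (simp only: power_mult_distrib)
  also have "\<dots> \<le> (9 / 10) ^ s"
    by (intro power_mono) (auto simp: field_simps)
  finally show ?thesis .
qed

text \<open>The choices of F, of the clauses and of the positions number at most 2^n, 8^n and 2^n,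
  together 2^(5n), so the confinement must supply 2^(-6n). Rounding costs a factor 2 in
  \<open>b\<close> and another in \<open>e\<close>, whence n \<le> 512 * Y * e * b; the constant is
  3072 = 6 * 512.\<close>

lemma crowded_bound:
  fixes k n m s Y :: nat
  assumes k: "2 ^ (3072 * Y) \<le> k" "128 \<le> k" and Y: "Y \<ge> 1" "Y * k \<le> n"
    and m: "m \<le> 2 ^ k * n" and s: "k * s \<le> n"
    and b: "b = n div (Y * k)" and e: "e = k div 128"
  shows "2 ^ n * ((m choose b) * 2 ^ (k * b) * (s / n) ^ (e * b)) \<le> (1 / 2) ^ n"
proof -
  have n0: "n > 0" using k(2) Y by (metis gr0I le_zero_eq mult_eq_0_iff not_numeral_le_zero not_one_le_zero)
  have Yk: "Y * k > 0" using Y k by simp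
  have b1: "b \<ge> 1" unfolding b using Y(2) Yk by (metis One_nat_def Suc_leI div_greater_zero_iff)
  have "Y * k * b \<le> n" by (simp add: b)
  moreover have "k * b \<le> Y * (k * b)" using Y(1) by simp
  ultimately have kb: "k * b \<le> n" by (simp only: mult.assoc)
  have "n < Y * k * (b + 1)" unfolding b using dividend_less_times_div[OF Yk, of n] by simp
  also have "\<dots> \<le> Y * k * (2 * b)" using b1 by (intro mult_left_mono) auto
  also have "k \<le> 256 * e"
  proof -
    have "k = 128 * e + k mod 128" "k mod 128 < 128" by (simp_all add: e)
    moreover have "e \<ge> 1" using k(2) by (simp add: e Suc_le_eq div_greater_zero_iff)
    ultimately show ?thesis by linarith
  qed
  then have "Y * k * (2 * b) \<le> Y * (256 * e) * (2 * b)" by (intro mult_left_mono mult_right_mono) auto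
  finally have Nn: "6 * n \<le> 3072 * Y * (e * b)" by (simp add: algebra_simps)
  have "real m ^ b \<le> real (2 ^ k * n) ^ b"
    using m by (intro power_mono of_nat_mono) auto
  then have "real m ^ b / fact b \<le> 2 ^ (k * b) * (real n ^ b / fact b)"
    by (simp add: power_mult_distrib power_mult divide_right_mono)
  also have "\<dots> \<le> 2 ^ (k * b) * 3 ^ n"
    by (intro mult_left_mono power_div_fact_le_three_power) auto
  also have "\<dots> \<le> 2 ^ (k * b) * 4 ^ n"
    by (intro mult_left_mono power_mono) auto
  finally have "real (m choose b) \<le> 2 ^ (k * b) * 4 ^ n"
    by (rule order_trans[OF choose_le_power_div_fact])
  also have "\<dots> \<le> 2 ^ n * 4 ^ n"
    using kb by (intro mult_right_mono power_increasing) auto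
  finally have c: "real (m choose b) \<le> 2 ^ n * 4 ^ n" .
  have kb2: "(2::real) ^ (k * b) \<le> 2 ^ n" using kb by (intro power_increasing) auto
  have "real (k * s) \<le> real n" using s by (rule of_nat_mono)
  then have "s / n \<le> 1 / k" using n0 k(2) by (simp add: field_simps)
  also have "\<dots> \<le> 1 / 2 ^ (3072 * Y)"
  proof -
    have "real (2 ^ (3072 * Y)) \<le> real k" using k(1) by (rule of_nat_mono)
    then show ?thesis using k(2) by (intro divide_left_mono) auto
  qed
  finally have "(s / n) ^ (e * b) \<le> (1 / 2 ^ (3072 * Y)) ^ (e * b)"
    by (intro power_mono) auto
  also have "\<dots> = 1 / 2 ^ (3072 * Y * (e * b))"
    by (simp only: power_divide power_one power_mult)
  also have "\<dots> \<le> 1 / 2 ^ (6 * n)"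
    using Nn by (intro divide_left_mono power_increasing) auto
  finally have sn: "(s / n) ^ (e * b) \<le> 1 / 2 ^ (6 * n)" .
  have "2 ^ n * ((m choose b) * 2 ^ (k * b) * (s / n) ^ (e * b))
      \<le> 2 ^ n * ((2 ^ n * 4 ^ n) * 2 ^ n * (1 / 2 ^ (6 * n)))"
    unfolding of_nat_mult of_nat_power of_nat_numeral
    by (intro mult_left_mono[OF mult_mono[OF mult_mono[OF c kb2] sn]]) auto
  also have "\<dots> = (2 * (2 * 4 * 2 * (1 / 2 ^ 6))) ^ n"
    by (simp only: power_mult_distrib power_mult power_divide power_one mult.assoc)
  also have "\<dots> = (1 / 2) ^ n" by simp
  finally show ?thesis .
qed

lemma sum_nat_half_powers_le: "(\<Sum>b\<in>{1..B}. real b * (1 / 2) ^ b) \<le> 2"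
proof -
  have "(\<Sum>b\<in>{1..B}. real b * (1 / 2) ^ b) = 2 - (B + 2) * (1 / 2) ^ B"
    by (induction B) (auto simp: field_simps)
  then show ?thesis by simp
qed

text \<open>Let x = kb/n, which is at most 1/Y. In the base 3 (m/b) 2^k x^e one factor x cancels
  m/b, another is kept, and the remaining e - 2 beat 6k * 4^k. This leaves x/2 to the power b;
  keeping a single x from the power yields the decay 1/n, and 2^-b makes the sum over b
  converge.\<close>

lemma repetitive_bound:
  fixes k n m Y :: nat
  assumes n0: "n > 0" and Y: "Y \<ge> 1" and e: "e \<ge> 2" "6 * k * 4 ^ k \<le> Y ^ (e - 2)"
    and m: "m \<le> 2 ^ k * n" and b0: "b0 = n div (Y * k)"
  shows "(\<Sum>b\<in>{1..b0}. (m choose b) * 2 ^ (k * b) * (real (k * b) / n) ^ (e * b)) \<le> 2 * k / n"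
proof -
  have term_le: "(m choose b) * 2 ^ (k * b) * (real (k * b) / n) ^ (e * b) \<le> k / n * (b * (1 / 2) ^ b)"
    if b: "b \<in> {1..b0}" for b
  proof -
    define x where "x = real (k * b) / n"
    have x0: "x \<ge> 0" by (simp add: x_def)
    have "Y * k * b \<le> Y * k * b0" using b by (intro mult_left_mono) auto
    also have "\<dots> \<le> n" by (simp add: b0)
    finally have "real (Y * (k * b)) \<le> real n" by (intro of_nat_mono) (simp add: mult.assoc)
    then have xY: "x \<le> 1 / Y" using n0 Y by (simp add: x_def field_simps)
    then have x1: "x \<le> 1" using Y by (simp add: order_trans[OF xY])
    have "real m \<le> real (2 ^ k * n)" using m by (rule of_nat_mono)
    then have mb: "m / b * x \<le> 2 ^ k * real k"
      using n0 b by (simp add: x_def field_simps mult_left_mono)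
    have "3 * (m / b) * 2 ^ k * x ^ e = 3 * 2 ^ k * (m / b * x) * (x ^ (e - 2) * x)"
    proof -
      have "x ^ e = x * (x ^ (e - 2) * x)"
      proof -
        have "e = Suc (Suc (e - 2))" using e(1) by simp
        then have "x ^ e = x ^ Suc (Suc (e - 2))" by (rule arg_cong)
        then show ?thesis by simp
      qed
      then show ?thesis by simp
    qed
    also have "\<dots> \<le> 3 * 2 ^ k * (2 ^ k * real k) * (x ^ (e - 2) * x)"
      by (rule mult_right_mono[OF mult_left_mono[OF mb]]) (use x0 in auto)
    also have "\<dots> = 3 * real k * 4 ^ k * x ^ (e - 2) * x"
    proof -
      have "(4::real) ^ k = 2 ^ k * 2 ^ k" by (simp flip: power_mult_distrib)
      then show ?thesis by simp
    qed
    also have "\<dots> \<le> 1 / 2 * x"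
    proof (rule mult_right_mono[OF _ x0])
      have "real (6 * k * 4 ^ k) \<le> real (Y ^ (e - 2))" using e(2) by (rule of_nat_mono)
      moreover have "x ^ (e - 2) \<le> (1 / Y) ^ (e - 2)" using x0 xY by (intro power_mono)
      ultimately have "real (6 * k * 4 ^ k) * x ^ (e - 2) \<le> real (Y ^ (e - 2)) * (1 / Y) ^ (e - 2)"
        using x0 by (intro mult_mono) auto
      also have "\<dots> = 1" using Y by (simp add: power_divide)
      finally show "3 * real k * 4 ^ k * x ^ (e - 2) \<le> 1 / 2" by simp
    qed
    finally have base: "3 * (m / b) * 2 ^ k * x ^ e \<le> 1 / 2 * x" .
    have "(m choose b) * 2 ^ (k * b) * x ^ (e * b) \<le> (3 * (m / b)) ^ b * 2 ^ (k * b) * x ^ (e * b)"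
      using choose_le_three_power[of b m] b x0 by (intro mult_right_mono) auto
    also have "\<dots> = (3 * (m / b) * 2 ^ k * x ^ e) ^ b"
      by (simp only: power_mult_distrib power_mult)
    also have "\<dots> \<le> (1 / 2 * x) ^ b"
      using base x0 by (intro power_mono) auto
    also have "\<dots> = (1 / 2) ^ b * x ^ b" by (simp only: power_mult_distrib)
    also have "\<dots> \<le> (1 / 2) ^ b * x ^ 1"
      using x0 x1 b by (intro mult_left_mono power_decreasing) auto
    also have "\<dots> = k / n * (b * (1 / 2) ^ b)" by (simp add: x_def)
    finally show ?thesis by (simp add: x_def)
  qed
  have "(\<Sum>b\<in>{1..b0}. (m choose b) * 2 ^ (k * b) * (real (k * b) / n) ^ (e * b))
      \<le> (\<Sum>b\<in>{1..b0}. k / n * (b * (1 / 2) ^ b))"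
    by (rule sum_mono) (rule term_le)
  also have "\<dots> = k / n * (\<Sum>b\<in>{1..b0}. b * (1 / 2) ^ b)"
    by (simp only: sum_distrib_left)
  also have "\<dots> \<le> k / n * 2"
    by (intro mult_left_mono sum_nat_half_powers_le) auto
  finally show ?thesis by (simp add: mult.commute)
qed

text \<open>The left side is at most 2^(3k). With e = \<open>k div 128\<close> one has 3k \<le> 384e
  + 381, and this is below 400(e - 2) as soon as e is at least 74.\<close>

lemma linear_times_power_bound:
  assumes "k \<ge> 10000"
  shows "6 * k * 4 ^ k \<le> (2 ^ 400) ^ (k div 128 - 2)"
proof -
  define e where "e = k div 128"
  have "k = 128 * e + k mod 128" "k mod 128 < 128" by (simp_all add: e_def)
  then have e: "e \<ge> 74" "k \<le> 128 * e + 127" using assms by linarith+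
  have "6 * k \<le> 2 ^ k"
  proof -
    have "6 * l \<le> 2 ^ l" if "l \<ge> 5" for l :: nat
      using that by (induction l rule: dec_induct) auto
    then show ?thesis using assms by simp
  qed
  then have "6 * k * 4 ^ k \<le> 2 ^ k * 4 ^ k" by (rule mult_right_mono) simp
  also have "\<dots> = 2 ^ (3 * k)"
    by (simp add: power_mult flip: power_mult_distrib)
  also have "\<dots> \<le> 2 ^ (400 * (e - 2))"
    using e by (intro power_increasing) auto
  finally show ?thesis by (simp only: power_mult e_def)
qed

section \<open>Success probability and its limit\<close>

lemma prob_walksat_success:
  assumes "n > 0"
  shows "measure_pmf.prob (walksat_experiment k n m t) walksat_success
    = 1 - measure_pmf.expectation (random_k_cnf k n m)
        (\<lambda>\<Phi>. measure_pmf.prob (walk_trace \<Phi> t (\<lambda>_. True)) {p. length p = t})"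
proof -
  have "measure_pmf.prob (walksat \<Phi> t) {out. (\<Phi>, out) \<in> walksat_success}
      = 1 - measure_pmf.prob (walk_trace \<Phi> t (\<lambda>_. True)) {p. length p = t}" for \<Phi>
  proof -
    have "measure_pmf.prob (walksat \<Phi> t) {out. (\<Phi>, out) \<in> walksat_success}
        = measure_pmf.prob (walksat \<Phi> t) (- {None})"
    proof (rule measure_pmf.finite_measure_eq_AE)
      show "AE out in measure_pmf (walksat \<Phi> t).
          out \<in> {out. (\<Phi>, out) \<in> walksat_success} \<longleftrightarrow> out \<in> - {None}"
        by (intro AE_pmfI) (auto simp: walksat_success_def walksat_def dest: walksat_from_sat)
    qed auto
    also have "\<dots> = 1 - measure_pmf.prob (walksat \<Phi> t) {None}"
      using measure_pmf.prob_compl[of "{None}" "walksat \<Phi> t"] by (simp add: Compl_eq_Diff_UNIV)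
    finally show ?thesis by (simp add: walksat_def prob_walksat_from_None)
  qed
  then have "measure_pmf.prob (walksat_experiment k n m t) walksat_success
      = measure_pmf.expectation (random_k_cnf k n m)
        (\<lambda>\<Phi>. 1 - measure_pmf.prob (walk_trace \<Phi> t (\<lambda>_. True)) {p. length p = t})"
    unfolding walksat_experiment_def
    by (simp add: prob_bind_pmf map_pmf_def[symmetric] vimage_def)
  then show ?thesis using assms by simp
qed

lemma walksat_success_bound:
  fixes r :: real and k n Y :: nat
  defines "m \<equiv> nat \<lceil>r * real n\<rceil>"
  assumes Y: "Y = 2 ^ 400" and k: "2 ^ (3072 * Y) \<le> k" "k \<ge> 10000"
    and r: "0 < r" "r \<le> 1 / 25 * (2 ^ k / real k)"
    and n: "n \<ge> Y * k" "n div k \<ge> 100"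
  shows "1 - ((9 / 10) ^ (n div k) + (1 / 2) ^ n + 2 * k / n + (1 / 2) ^ (n div k))
    \<le> measure_pmf.prob (walksat_experiment k n m n) walksat_success"
proof -
  define s where "s = n div k"
  define e where "e = k div 128"
  define b0 where "b0 = n div (Y * k)"
  have Y1: "Y \<ge> 1" unfolding Y by (rule one_le_power) simp
  have n0: "n > 0" using n(2) by (cases n) auto
  have ks: "k * s \<le> n" by (simp add: s_def)
  have "r * n \<le> 1 / 25 * (2 ^ k / k) * n" using r(2) by (rule mult_right_mono) simp
  moreover have "real m \<le> r * n + 1" unfolding m_def using r(1) n0 by (simp add: of_nat_nat)
  ultimately have m1: "real m \<le> 2 ^ k * n / (25 * k) + 1" by simp
  have m2: "m \<le> 2 ^ k * n"
  proof -
    have "2 ^ k * real n / (25 * k) \<le> 2 ^ k * real n / 2"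
      using k(2) by (intro divide_left_mono) auto
    moreover have "2 \<le> 2 ^ k * real n"
    proof -
      have "(2::real) ^ 1 * 1 \<le> 2 ^ k * real n"
        using n0 k(2) by (intro mult_mono power_increasing) auto
      then show ?thesis by simp
    qed
    ultimately have "real m \<le> real (2 ^ k * n)" using m1 by simp
    then show ?thesis by (simp only: of_nat_le_iff)
  qed
  \<comment> \<open>Four suffices for the last term: 2^n 8^s / 4^n = 8^s / 2^n is at most 2^(3s -
    4s).\<close>
  have "k * s \<ge> 4 * s" using k(2) by (intro mult_right_mono) auto
  then have "4 * s \<le> n" using ks by linarith
  have "2 ^ n * 8 ^ s / 4 ^ n = (8 ^ s / 2 ^ n :: real)"
  proof -
    have "(4::real) ^ n = 2 ^ n * 2 ^ n" by (simp flip: power_mult_distrib)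
    then show ?thesis by simp
  qed
  also have "\<dots> \<le> 8 ^ s / 2 ^ (4 * s)"
    using \<open>4 * s \<le> n\<close> by (intro divide_left_mono power_increasing) auto
  also have "\<dots> = (1 / 2) ^ s"
    by (simp add: power_mult flip: power_divide)
  finally have T4: "2 ^ n * 8 ^ s / 4 ^ n \<le> (1 / 2 :: real) ^ s" .
  have T1: "(m choose s) * (((1 + s / n) / 2) ^ (k - 1) * (1 + 11 / k)) ^ s \<le> (9 / 10) ^ s"
    by (rule many_touched_bound[OF _ s_def _ m1]) (use k n in \<open>auto simp: s_def\<close>)
  have T2: "2 ^ n * ((m choose b0) * 2 ^ (k * b0) * (s / n) ^ (e * b0)) \<le> (1 / 2) ^ n"
    by (rule crowded_bound[OF k(1) _ Y1 n(1) m2 ks b0_def e_def]) (use k(2) in simp)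
  have T3: "(\<Sum>b\<in>{1..b0}. (m choose b) * 2 ^ (k * b) * (real (k * b) / n) ^ (e * b)) \<le> 2 * k / n"
  proof (rule repetitive_bound[OF n0 Y1 _ _ m2 b0_def])
    have "k = 128 * e + k mod 128" "k mod 128 < 128" by (simp_all add: e_def)
    then show "e \<ge> 2" using k(2) by linarith
    show "6 * k * 4 ^ k \<le> Y ^ (e - 2)"
      unfolding Y e_def by (rule linear_times_power_bound[OF k(2)])
  qed
  have k0: "k > 0" using k(2) by simp
  have e128: "128 * e \<le> k" unfolding e_def by simp
  have "measure_pmf.expectation (random_k_cnf k n m)
      (\<lambda>\<Phi>. measure_pmf.prob (walk_trace \<Phi> n (\<lambda>_. True)) {p. length p = n})
    \<le> (9 / 10) ^ s + (1 / 2) ^ n + 2 * k / n + (1 / 2) ^ s"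
    by (rule order_trans[OF expectation_failure_le[OF n0 k0 ks e128, of m n b0]
      add_mono[OF add_mono[OF add_mono[OF T1 T2] T3] T4]])
  then show ?thesis
    unfolding prob_walksat_success[OF n0] s_def[symmetric] by (rule diff_left_mono)
qed

theorem theorem1:
  shows "\<exists>k0::nat. k0 > 3 \<and>
    (\<forall>k::nat. \<forall>r::real. k \<ge> k0 \<longrightarrow> 0 < r \<longrightarrow> r \<le> 1 / 25 * (2 ^ k / real k) \<longrightarrow>
      (\<lambda>n::nat. measure_pmf.prob
          (walksat_experiment k n (nat \<lceil>r * real n\<rceil>) n) walksat_success) \<longlonglongrightarrow> 1)"
proof -
  \<comment> \<open>Repetitive sets of at most \<open>n / (Y k)\<close> clauses are rare because \<open>400 / 128 > 3\<close>, so that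
    \<open>Y\<close> to the power \<open>k div 128\<close> outgrows \<open>8 ^ k\<close>; larger crowded sets are rare once \<open>k\<close> is
    huge compared with \<open>Y\<close>, since they gain a factor \<open>1 / k\<close> for at least \<open>n / (512 Y)\<close> positions.\<close>
  define Y where "Y = (2 ^ 400 :: nat)"
  have conv: "(\<lambda>n::nat. measure_pmf.prob
      (walksat_experiment k n (nat \<lceil>r * real n\<rceil>) n) walksat_success) \<longlonglongrightarrow> 1"
    if k: "2 ^ (3072 * Y) \<le> k" "k \<ge> 10000" and r: "0 < r" "r \<le> 1 / 25 * (2 ^ k / real k)"
    for k :: nat and r :: real
  proof (rule tendsto_sandwich)
    have div: "filterlim (\<lambda>n. n div k) at_top sequentially"
      using k(2) by (intro filterlim_at_top_div_const_nat) simp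
    show "\<forall>\<^sub>F n in sequentially.
        1 - ((9 / 10) ^ (n div k) + (1 / 2) ^ n + 2 * k / n + (1 / 2) ^ (n div k))
        \<le> measure_pmf.prob (walksat_experiment k n (nat \<lceil>r * real n\<rceil>) n) walksat_success"
      using eventually_ge_at_top[of "Y * k"] div[unfolded filterlim_at_top, rule_format, of 100]
      by eventually_elim (rule walksat_success_bound[OF Y_def k r])
    show "\<forall>\<^sub>F n in sequentially. measure_pmf.prob
        (walksat_experiment k n (nat \<lceil>r * real n\<rceil>) n) walksat_success \<le> 1"
      by simp
    have pow: "(\<lambda>n. c ^ (n div k)) \<longlonglongrightarrow> 0" if "0 \<le> c" "c < 1" for c :: real
      by (rule filterlim_compose[OF LIMSEQ_realpow_zero[OF that] div])
    have "(\<lambda>n. 1 - ((9 / 10) ^ (n div k) + (1 / 2) ^ n + 2 * k / n + (1 / 2) ^ (n div k)))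
        \<longlonglongrightarrow> 1 - (0 + 0 + 0 + 0 :: real)"
      by (intro tendsto_diff tendsto_const tendsto_add pow LIMSEQ_realpow_zero lim_const_over_n) auto
    then show "(\<lambda>n. 1 - ((9 / 10) ^ (n div k) + (1 / 2) ^ n + 2 * k / n + (1 / 2) ^ (n div k)))
        \<longlonglongrightarrow> (1::real)"
      by simp
  qed simp
  define N where "N = (2::nat) ^ (3072 * Y)"
  show ?thesis
  proof (intro exI[of _ "max N 10000"] conjI allI impI)
    show "max N 10000 > 3" by simp
    fix k :: nat and r :: real
    assume "max N 10000 \<le> k" "0 < r" "r \<le> 1 / 25 * (2 ^ k / real k)"
    then show "(\<lambda>n::nat. measure_pmf.prob
        (walksat_experiment k n (nat \<lceil>r * real n\<rceil>) n) walksat_success) \<longlonglongrightarrow> 1"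
      by (intro conv) (auto simp: N_def)
  qed
qed

end
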